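(* Let $a,b>0$ and let $g:\mathbb{R}\to\mathbb{C}$ be a measurable function. The following are equivalent: (1) There is a constant $B>0$ so that $\sum_{n\in\mathbb{Z}}|g(t-na)|^2\le B$ for almost every $t\in\mathbb{R}$. (2) The WH-frame Identity (for the system $(g,a,b)$) holds for all compactly supported functions $f\in L^2(\mathbb{R})$.
   Context: For $c\in\mathbb{R}$ let $T_cf(x)=f(x-c)$ and $E_cf(x)=e^{2\pi i c x}f(x)$. Write $\langle f,h\rangle=\int_{\mathbb{R}}f\overline{h}$. For $k\in\mathbb{Z}$ put $G_k(t)=\sum_{n\in\mathbb{Z}}g(t-na)\overline{g(t-na-k/b)}$. The WH-frame Identity for $f$ is $$\sum_{m,n\in\mathbb{Z}}|\langle f,E_{mb}T_{na}g\rangle|^2=\frac1b\sum_{k\in\mathbb{Z}}\int_{\mathbb{R}}\overline{f(t)}f(t-k/b)G_k(t)\,dt .$$ The WH-frame Identity "holds for $f$" means: the series on the left sums to a finite number and is equal to the series on the right, which converges unconditionally. This includes that all terms are well defined and finite: the integrals defining $\langle f,E_{mb}T_{na}g\rangle$ converge absolutely, and for each $k$ the integrand $\overline{f(t)}f(t-k/b)G_k(t)$ is integrable, where the integrand is taken to be $0$ where $\overline{f(t)}f(t-k/b)=0$ and the sum defining $G_k(t)$ converges absolutely for almost every other $t$. *)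

theory Defs
  imports "HOL-Analysis.Analysis"
begin

definition translation :: "real \<Rightarrow> (real \<Rightarrow> complex) \<Rightarrow> real \<Rightarrow> complex" where
  "translation c f x = f (x - c)"

definition modulation :: "real \<Rightarrow> (real \<Rightarrow> complex) \<Rightarrow> real \<Rightarrow> complex" where
  "modulation c f x =
     exp (2 * complex_of_real pi * \<i> * complex_of_real c * complex_of_real x) * f x"

definition L2_inner :: "(real \<Rightarrow> complex) \<Rightarrow> (real \<Rightarrow> complex) \<Rightarrow> complex" where
  "L2_inner f h = (LINT x|lebesgue. f x * cnj (h x))"

definition square_integrable :: "(real \<Rightarrow> complex) \<Rightarrow> bool" where
  "square_integrable f \<longleftrightarrow>
     f \<in> borel_measurable lebesgue \<and> integrable lebesgue (\<lambda>x. (cmod (f x))\<^sup>2)"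

definition compactly_supported :: "(real \<Rightarrow> complex) \<Rightarrow> bool" where
  "compactly_supported f \<longleftrightarrow> compact (closure {x. f x \<noteq> 0})"

definition WH_atom ::
  "(real \<Rightarrow> complex) \<Rightarrow> real \<Rightarrow> real \<Rightarrow> int \<Rightarrow> int \<Rightarrow> real \<Rightarrow> complex" where
  "WH_atom g a b m n = modulation (of_int m * b) (translation (of_int n * a) g)"

definition G_term ::
  "(real \<Rightarrow> complex) \<Rightarrow> real \<Rightarrow> real \<Rightarrow> int \<Rightarrow> real \<Rightarrow> int \<Rightarrow> complex" where
  "G_term g a b k t n = g (t - of_int n * a) * cnj (g (t - of_int n * a - of_int k / b))"

definition G :: "(real \<Rightarrow> complex) \<Rightarrow> real \<Rightarrow> real \<Rightarrow> int \<Rightarrow> real \<Rightarrow> complex" where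
  "G g a b k t = (\<Sum>\<^sub>\<infinity>n. G_term g a b k t n)"

text \<open>
  Since \<^const>\<open>G\<close> is total, \<open>WH_integrand\<close> is automatically \<open>0\<close> wherever
  \<open>cnj (f t) * f (t - k / b) = 0\<close>, whether or not the series for \<^const>\<open>G\<close> converges at \<open>t\<close>.
\<close>

definition WH_integrand ::
  "(real \<Rightarrow> complex) \<Rightarrow> real \<Rightarrow> real \<Rightarrow> (real \<Rightarrow> complex) \<Rightarrow> int \<Rightarrow> real \<Rightarrow> complex" where
  "WH_integrand g a b f k t = cnj (f t) * f (t - of_int k / b) * G g a b k t"

text \<open>
  The first three conjuncts say that every term is well defined and finite; the library's
  integrals and infinite sums return \<open>0\<close> when they do not converge. Summability in the sense of
  \<^const>\<open>summable_on\<close> is unconditional convergence.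
\<close>

definition WH_frame_identity ::
  "(real \<Rightarrow> complex) \<Rightarrow> real \<Rightarrow> real \<Rightarrow> (real \<Rightarrow> complex) \<Rightarrow> bool" where
  "WH_frame_identity g a b f \<longleftrightarrow>
     (\<forall>m n. integrable lebesgue (\<lambda>x. f x * cnj (WH_atom g a b m n x))) \<and>
     (\<forall>k::int. AE t in lebesgue. cnj (f t) * f (t - of_int k / b) \<noteq> 0 \<longrightarrow>
        (\<lambda>n. cmod (G_term g a b k t n)) summable_on UNIV) \<and>
     (\<forall>k. integrable lebesgue (WH_integrand g a b f k)) \<and>
     (\<lambda>(m, n). (cmod (L2_inner f (WH_atom g a b m n)))\<^sup>2) summable_on UNIV \<and>
     (\<lambda>k. LINT t|lebesgue. WH_integrand g a b f k t) summable_on UNIV \<and>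
     complex_of_real (\<Sum>\<^sub>\<infinity>(m, n). (cmod (L2_inner f (WH_atom g a b m n)))\<^sup>2) =
       1 / complex_of_real b * (\<Sum>\<^sub>\<infinity>k. LINT t|lebesgue. WH_integrand g a b f k t)"

end

theory Submission
  imports Defs
begin

text \<open>
  \<^bold>\<open>Bounded orbit sums give the identity.\<close> Fix \<open>n\<close> and put \<open>h(t) = f(t) cnj (g(t - n a))\<close>, which is
  square-integrable with bounded support because \<open>g\<close> is essentially bounded. The numbers
  \<open>\<langle>f, E\<^bsub>mb\<^esub> T\<^bsub>na\<^esub> g\<rangle>\<close> are the Fourier coefficients, on a period cell of length \<open>1/b\<close>, of the
  periodization of \<open>h\<close> (a finite sum of translates). Parseval's identity on the cell turns the sum
  of their squares over \<open>m\<close> into the norm of the periodization, and multiplying this norm out and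
  gluing the cells together gives
  \<open>1/b * (\<Sum>k. \<integral> cnj (h(t)) h(t - k/b) dt)\<close>, in which only finitely many \<open>k\<close> contribute
  (\<open>parseval_bounded_support\<close>). Here
  \<open>cnj (h(t)) h(t - k/b) = cnj (f(t)) f(t - k/b) g(t - n a) cnj (g(t - n a - k/b))\<close>, so what is
  left is to sum over \<open>n\<close> under the integral. By \<open>2xy \<le> x\<^sup>2 + y\<^sup>2\<close> the orbit bound at
  \<open>t\<close> and at \<open>t - k/b\<close> bounds the absolute series of \<open>G\<^sub>k\<close> by \<open>B\<close>, so dominated convergence
  applies (\<open>has_sum_integral_int\<close>).

  \<^bold>\<open>The identity gives bounded orbit sums.\<close> The information comes from the finiteness of the term
  \<open>k = 0\<close> for functions supported in the single period \<open>[0,a]\<close>: the product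
  \<open>\<bar>f\<bar>\<^sup>2 G\<^sub>0\<close> is integrable for every such \<open>f\<close> in \<open>L\<^sup>2\<close>. A nonnegative function all of whose
  products with nonnegative integrable functions are integrable is essentially bounded
  (\<open>AE_bounded_if_products_integrable\<close>), so \<open>G\<^sub>0\<close>, the sum of \<open>\<bar>g(t - n a)\<bar>\<^sup>2\<close> over \<open>n\<close>, is
  essentially bounded on \<open>[0,a]\<close>, and it has period \<open>a\<close>.

  Parseval's identity itself is proved from Bessel's: the least-squares formula
  \<open>integral_norm_diff_trig_sum\<close> reduces it to the density of trigonometric polynomials in
  \<open>L\<^sup>2\<close> of the cell, which follows by truncation, approximation of measurable functions by
  continuous ones almost everywhere, and the Stone--Weierstrass theorem on the circle.
\<close>

section \<open>Square-integrable functions\<close>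

definition L2 :: "'a measure \<Rightarrow> ('a \<Rightarrow> complex) \<Rightarrow> bool" where
  "L2 M f \<longleftrightarrow> f \<in> borel_measurable M \<and> integrable M (\<lambda>x. (cmod (f x))\<^sup>2)"

lemma mult_le_sum_squares: "x * y \<le> x\<^sup>2 + y\<^sup>2" for x y :: real
proof (cases "0 \<le> x * y")
  case True
  with sum_squares_bound[of x y] show ?thesis by linarith
next
  case False
  with zero_le_power2[of x] zero_le_power2[of y] show ?thesis by linarith
qed

lemma borel_measurable_cnj [measurable (raw)]:
  "f \<in> borel_measurable M \<Longrightarrow> (\<lambda>x. cnj (f x)) \<in> borel_measurable M"
  by (rule borel_measurable_continuous_on[where f = cnj]) (intro continuous_intros)

lemma L2_mult_integrable:
  assumes "L2 M f" "L2 M g"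
  shows "integrable M (\<lambda>x. f x * cnj (g x))"
proof (rule Bochner_Integration.integrable_bound)
  show "integrable M (\<lambda>x. (cmod (f x))\<^sup>2 + (cmod (g x))\<^sup>2)"
    using assms by (auto simp: L2_def)
  show "(\<lambda>x. f x * cnj (g x)) \<in> borel_measurable M"
    using assms by (auto simp: L2_def)
  show "AE x in M. norm (f x * cnj (g x)) \<le> norm ((cmod (f x))\<^sup>2 + (cmod (g x))\<^sup>2)"
    by (auto simp: norm_mult intro!: AE_I2 mult_le_sum_squares)
qed

lemma norm_add_squared_le: "(cmod (u + v))\<^sup>2 \<le> 2 * ((cmod u)\<^sup>2 + (cmod v)\<^sup>2)"
proof -
  have "(cmod (u + v))\<^sup>2 \<le> (cmod u + cmod v)\<^sup>2"
    by (simp add: norm_triangle_ineq power_mono)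
  also have "\<dots> \<le> 2 * ((cmod u)\<^sup>2 + (cmod v)\<^sup>2)"
    using sum_squares_bound[of "cmod u" "cmod v"] by (simp add: power2_sum)
  finally show ?thesis .
qed

lemma L2_add:
  assumes "L2 M f" "L2 M g"
  shows "L2 M (\<lambda>x. f x + g x)"
  unfolding L2_def
proof
  show "(\<lambda>x. f x + g x) \<in> borel_measurable M"
    using assms by (auto simp: L2_def)
  show "integrable M (\<lambda>x. (cmod (f x + g x))\<^sup>2)"
  proof (rule Bochner_Integration.integrable_bound)
    show "integrable M (\<lambda>x. 2 * ((cmod (f x))\<^sup>2 + (cmod (g x))\<^sup>2))"
      using assms by (auto simp: L2_def)
  qed (use assms norm_add_squared_le in \<open>auto simp: L2_def\<close>)
qed

lemma L2_cmult: "L2 M f \<Longrightarrow> L2 M (\<lambda>x. c * f x)"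
  by (auto simp: L2_def norm_mult power_mult_distrib)

lemma L2_diff:
  assumes "L2 M f" "L2 M g"
  shows "L2 M (\<lambda>x. f x - g x)"
  using L2_add[OF assms(1) L2_cmult[OF assms(2), of "-1"]] by simp

lemma L2_sum: "finite I \<Longrightarrow> (\<And>i. i \<in> I \<Longrightarrow> L2 M (f i)) \<Longrightarrow> L2 M (\<lambda>x. \<Sum>i\<in>I. f i x)"
proof (induction rule: finite_induct)
  case empty
  then show ?case by (simp add: L2_def)
next
  case (insert i I)
  then show ?case using L2_add[of M "f i" "\<lambda>x. \<Sum>i\<in>I. f i x"] by simp
qed

lemma L2_bounded:
  assumes "finite_measure M" "f \<in> borel_measurable M" "\<And>x. cmod (f x) \<le> C"
  shows "L2 M f"
  unfolding L2_def
proof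
  show "integrable M (\<lambda>x. (cmod (f x))\<^sup>2)"
  proof (rule finite_measure.integrable_const_bound[OF assms(1), of _ "C\<^sup>2"])
    show "AE x in M. norm ((cmod (f x))\<^sup>2) \<le> C\<^sup>2"
      using assms(3) by (auto intro!: AE_I2 power_mono)
  qed (use assms in auto)
qed (use assms in auto)

text \<open>
  Every passage to the limit in the density argument has this form. The error is dominated by
  \<open>2 (\<bar>f\<bar>\<^sup>2 + w\<^sup>2)\<close>.
\<close>

lemma L2_dominated_convergence:
  assumes f: "L2 M f" and h: "\<And>n. h n \<in> borel_measurable M"
    and w: "integrable M (\<lambda>x. (w x)\<^sup>2)" and bnd: "\<And>n. AE x in M. cmod (h n x) \<le> w x"
    and lim: "AE x in M. (\<lambda>n. h n x) \<longlonglongrightarrow> f x"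
  shows "(\<lambda>n. LINT x|M. (cmod (f x - h n x))\<^sup>2) \<longlonglongrightarrow> 0"
proof -
  have "(\<lambda>n. LINT x|M. (cmod (f x - h n x))\<^sup>2) \<longlonglongrightarrow> (LINT x|M. 0::real)"
  proof (rule integral_dominated_convergence)
    show "(\<lambda>x. 0::real) \<in> borel_measurable M" by simp
    show "(\<lambda>x. (cmod (f x - h n x))\<^sup>2) \<in> borel_measurable M" for n
      using f h by (auto simp: L2_def)
    show "integrable M (\<lambda>x. 2 * ((cmod (f x))\<^sup>2 + (w x)\<^sup>2))"
      using f w by (auto simp: L2_def)
    show "AE x in M. (\<lambda>n. (cmod (f x - h n x))\<^sup>2) \<longlonglongrightarrow> 0"
      using lim
    proof eventually_elim
      case (elim x)
      have "(\<lambda>n. (cmod (f x - h n x))\<^sup>2) \<longlonglongrightarrow> (cmod (f x - f x))\<^sup>2"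
        by (intro tendsto_intros elim)
      then show ?case by simp
    qed
    show "AE x in M. norm ((cmod (f x - h n x))\<^sup>2) \<le> 2 * ((cmod (f x))\<^sup>2 + (w x)\<^sup>2)" for n
      using bnd[of n]
    proof eventually_elim
      case (elim x)
      then have "(cmod (h n x))\<^sup>2 \<le> (w x)\<^sup>2" by (simp add: power_mono)
      with norm_add_squared_le[of "f x" "- h n x"] show ?case by simp
    qed
  qed
  then show ?thesis by simp
qed

section \<open>Characters and trigonometric polynomials on a period cell\<close>

definition echar :: "real \<Rightarrow> int \<Rightarrow> real \<Rightarrow> complex" where
  "echar b m x = exp (2 * complex_of_real pi * \<i> * complex_of_real (of_int m * b) * complex_of_real x)"

lemma echar_add: "echar b (m + n) x = echar b m x * echar b n x"
  by (simp add: echar_def algebra_simps flip: exp_add)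

lemma cnj_echar: "cnj (echar b m x) = echar b (- m) x"
  by (simp add: echar_def exp_cnj)

lemma norm_echar [simp]: "cmod (echar b m x) = 1"
  by (simp add: echar_def)

lemma echar_zero [simp]: "echar b 0 x = 1"
  by (simp add: echar_def)

lemma continuous_on_echar [continuous_intros]: "continuous_on S (echar b m)"
  unfolding echar_def by (intro continuous_intros)

lemma echar_borel [measurable]: "echar b m \<in> borel_measurable borel"
  by (intro borel_measurable_continuous_onI continuous_intros)

lemma echar_lebesgue [measurable]: "echar b m \<in> borel_measurable lebesgue"
  by (simp add: measurable_completion)

lemma echar_shift:
  assumes "b > 0" shows "echar b m (x + of_int k / b) = echar b m x"
proof -
  have "echar b m (x + of_int k / b) = echar b m x * exp (2 * of_int (m * k) * complex_of_real pi * \<i>)"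
    using assms unfolding echar_def exp_add[symmetric]
    by (intro arg_cong[where f = exp]) (simp add: field_simps)
  also have "exp (2 * of_int (m * k) * complex_of_real pi * \<i>) = 1"
    using exp_integer_2pi[of "real_of_int (m * k)"] by (simp add: mult_ac)
  finally show ?thesis by simp
qed

text \<open>
  The cell is half-open so that its translates by integer multiples of \<open>1/b\<close> tile the line exactly.
\<close>

abbreviation cell :: "real \<Rightarrow> real set" where
  "cell b \<equiv> {0..<1/b}"

abbreviation cellM :: "real \<Rightarrow> real measure" where
  "cellM b \<equiv> lebesgue_on (cell b)"

lemma finite_measure_cell: "finite_measure (cellM b)"
  by (rule finite_measure_lebesgue_on) (auto intro!: bounded_set_imp_lmeasurable)

lemma echar_cell [measurable]: "echar b m \<in> borel_measurable (cellM b)"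
  by (rule measurable_restrict_space1) measurable

lemma L2_echar: "L2 (cellM b) (echar b m)"
  by (rule L2_bounded[OF finite_measure_cell, of _ _ 1]) auto

lemma integrable_echar: "integrable (cellM b) (echar b m)"
  by (rule finite_measure.integrable_const_bound[OF finite_measure_cell, where B = 1]) auto

lemma integral_echar:
  assumes "b > 0"
  shows "(LINT x|cellM b. echar b m x) = (if m = 0 then 1 / complex_of_real b else 0)"
proof (cases "m = 0")
  case True
  then show ?thesis
    using assms by (simp add: measure_restrict_space scaleR_conv_of_real)
next
  case False
  define \<theta> where "\<theta> = 2 * complex_of_real pi * \<i> * complex_of_real (of_int m * b)"
  have \<theta>: "\<theta> \<noteq> 0" using False assms by (auto simp: \<theta>_def)
  have "((\<lambda>x. exp (\<theta> * complex_of_real x)) has_integral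
          exp (\<theta> * complex_of_real (1/b)) / \<theta> - exp (\<theta> * complex_of_real 0) / \<theta>) {0..1/b}"
  proof (rule fundamental_theorem_of_calculus)
    show "0 \<le> 1 / b" using assms by simp
    fix x :: real
    have "((\<lambda>z. exp (\<theta> * z) / \<theta>) has_field_derivative exp (\<theta> * complex_of_real x))
        (at (complex_of_real x))"
      using \<theta> by (auto intro!: derivative_eq_intros)
    from has_vector_derivative_real_field[OF this]
    show "((\<lambda>x. exp (\<theta> * complex_of_real x) / \<theta>) has_vector_derivative
        exp (\<theta> * complex_of_real x)) (at x within {0..1/b})" .
  qed
  moreover have "exp (\<theta> * complex_of_real (1/b)) = exp (\<theta> * complex_of_real 0)"
    using echar_shift[OF assms, of m 0 1] by (simp add: echar_def \<theta>_def)
  ultimately have "(echar b m has_integral 0) {0..1/b}"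
    by (simp add: echar_def[abs_def] \<theta>_def)
  then have "(echar b m has_integral 0) (cell b)"
    by (subst has_integral_spike_set_eq[where T = "{0..1/b}"])
      (auto intro: negligible_subset[of "{1/b}"])
  moreover have "(echar b m has_integral (LINT x|cellM b. echar b m x)) (cell b)"
    by (rule has_integral_integral_lebesgue_on[OF integrable_echar]) auto
  ultimately show ?thesis using False by (metis has_integral_unique)
qed

text \<open>
  Generating the trigonometric polynomials inductively makes closure under multiplication a
  routine double induction; \<open>trig_poly_finite_sum\<close> recovers a sum with distinct frequencies.
\<close>

inductive trig_poly :: "real \<Rightarrow> (real \<Rightarrow> complex) \<Rightarrow> bool" for b where
  monomial: "trig_poly b (\<lambda>x. c * echar b m x)"
| add: "trig_poly b f \<Longrightarrow> trig_poly b g \<Longrightarrow> trig_poly b (\<lambda>x. f x + g x)"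

lemma trig_poly_const: "trig_poly b (\<lambda>x. c)"
  using trig_poly.monomial[of b c 0] by simp

lemma trig_poly_mult:
  assumes "trig_poly b f" "trig_poly b g"
  shows "trig_poly b (\<lambda>x. f x * g x)"
  using assms
proof (induction)
  case (monomial c m)
  from monomial show ?case
  proof (induction)
    case (monomial c' m')
    have "(\<lambda>x. c * echar b m x * (c' * echar b m' x)) = (\<lambda>x. (c * c') * echar b (m + m') x)"
      by (simp add: echar_add fun_eq_iff)
    then show ?case using trig_poly.monomial[of b "c * c'" "m + m'"] by simp
  next
    case (add f g)
    then show ?case using trig_poly.add by (fastforce simp: distrib_left)
  qed
next
  case (add f g')
  then show ?case using trig_poly.add by (fastforce simp: distrib_right)
qed

lemma trig_poly_cmult: "trig_poly b f \<Longrightarrow> trig_poly b (\<lambda>x. c * f x)"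
  by (rule trig_poly_mult[OF trig_poly_const])

lemma trig_poly_finite_sum:
  assumes "trig_poly b T"
  shows "\<exists>F d. finite F \<and> T = (\<lambda>x. \<Sum>m\<in>F. d m * echar b m x)"
proof -
  have "\<exists>F d. finite F \<and> (\<forall>m. m \<notin> F \<longrightarrow> d m = 0) \<and> T = (\<lambda>x. \<Sum>m\<in>F. d m * echar b m x)"
    using assms
  proof (induction)
    case (monomial c m)
    show ?case
      by (rule exI[of _ "{m}"], rule exI[of _ "\<lambda>k. if k = m then c else 0"]) auto
  next
    case (add f g)
    then obtain F d F' d' where *: "finite F" "\<forall>m. m \<notin> F \<longrightarrow> d m = 0"
      "f = (\<lambda>x. \<Sum>m\<in>F. d m * echar b m x)" "finite F'" "\<forall>m. m \<notin> F' \<longrightarrow> d' m = 0"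
      "g = (\<lambda>x. \<Sum>m\<in>F'. d' m * echar b m x)"
      by blast
    have f: "f x = (\<Sum>m\<in>F \<union> F'. d m * echar b m x)" for x
      unfolding *(3) using * by (intro sum.mono_neutral_left) auto
    have g: "g x = (\<Sum>m\<in>F \<union> F'. d' m * echar b m x)" for x
      unfolding *(6) using * by (intro sum.mono_neutral_left) auto
    show ?case
      by (rule exI[of _ "F \<union> F'"], rule exI[of _ "\<lambda>m. d m + d' m"])
        (use * in \<open>auto simp: f g fun_eq_iff distrib_right sum.distrib simp del: *(3,6)\<close>)
  qed
  then show ?thesis by blast
qed

lemma trig_poly_L2: "trig_poly b T \<Longrightarrow> L2 (cellM b) T"
  by (induction rule: trig_poly.induct) (auto intro: L2_add L2_cmult L2_echar)

text \<open>
  On the unit circle \<open>cnj z\<close> is the character of frequency \<open>-1\<close>, so the real and imaginary parts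
  of \<open>z\<close>, and with them all real polynomials in these two coordinates, become trigonometric
  polynomials.
\<close>

lemma trig_poly_of_real_polynomial:
  assumes "real_polynomial_function (p :: complex \<Rightarrow> real)"
  shows "trig_poly b (\<lambda>x. complex_of_real (p (echar b 1 x)))"
  using assms
proof (induction)
  case (linear f)
  then interpret bounded_linear f .
  have f: "f z = Re z * f 1 + Im z * f \<i>" for z
    by (metis add scaleR complex_eq mult.commute real_scaleR_def scaleR_conv_of_real mult.right_neutral)
  have re: "complex_of_real (Re z) = (z + cnj z) / 2" and im: "complex_of_real (Im z) = (z - cnj z) / (2 * \<i>)" for z
    by (auto simp: complex_eq_iff)
  have "complex_of_real (f (echar b 1 x)) =
     (complex_of_real (f 1) / 2 + complex_of_real (f \<i>) / (2 * \<i>)) * echar b 1 x +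
     (complex_of_real (f 1) / 2 - complex_of_real (f \<i>) / (2 * \<i>)) * echar b (-1) x" for x
    by (subst f, unfold of_real_add of_real_mult re im cnj_echar) (simp add: field_simps)
  then show ?case by (auto intro!: trig_poly.intros)
qed (auto intro: trig_poly_const trig_poly.add trig_poly_mult)

lemma trig_poly_of_polynomial:
  assumes "polynomial_function (p :: complex \<Rightarrow> complex)"
  shows "trig_poly b (\<lambda>x. p (echar b 1 x))"
proof -
  have "real_polynomial_function (Re \<circ> p)" "real_polynomial_function (Im \<circ> p)"
    using assms bounded_linear_Re bounded_linear_Im unfolding polynomial_function_def by blast+
  from this[THEN trig_poly_of_real_polynomial, of b]
  have "trig_poly b (\<lambda>x. complex_of_real (Re (p (echar b 1 x))) + \<i> * complex_of_real (Im (p (echar b 1 x))))"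
    by (auto intro!: trig_poly.add trig_poly_cmult)
  then show ?thesis by (simp flip: complex_eq)
qed

text \<open>
  A continuous function with equal end values is a loop and therefore factors continuously through
  the circle. The continuity of the factor is that of the circle map which corresponds to a loop; it is
  obtained by applying the correspondence of homotopies to the constant homotopy.
\<close>

lemma loop_trig_poly_approx:
  fixes h :: "real \<Rightarrow> complex"
  assumes b: "b > 0" and cont: "continuous_on {0..1/b} h" and loop: "h 0 = h (1/b)" and e: "e > 0"
  shows "\<exists>T. trig_poly b T \<and> (\<forall>x\<in>cell b. cmod (h x - T x) < e)"
proof -
  define q where "q t = h (t / b)" for t
  have "continuous_on {0..1} q"
    unfolding q_def using b
    by (intro continuous_on_compose2[OF cont] continuous_intros) (auto simp: field_simps)
  then have hom: "homotopic_loops UNIV q q"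
    using loop by (simp add: homotopic_loops_refl path_def pathstart_def pathfinish_def q_def)
  define c :: "complex \<Rightarrow> complex" where "c = q \<circ> (\<lambda>z. Arg2pi z / (2 * pi))"
  have "continuous_on (sphere 0 1) c"
    using homotopic_with_imp_continuous[OF homotopic_loops_imp_homotopic_circlemaps[OF hom]]
    unfolding c_def by (rule conjunct1)
  from Stone_Weierstrass_polynomial_function[OF compact_sphere this e]
  obtain p where p: "polynomial_function p" "\<And>z. z \<in> sphere 0 1 \<Longrightarrow> cmod (c z - p z) < e"
    by auto
  have "cmod (h x - p (echar b 1 x)) < e" if "x \<in> cell b" for x
  proof -
    have "Arg2pi (echar b 1 x) = 2 * pi * b * x"
      using that b unfolding echar_def by (subst Arg2pi_exp) (auto simp: field_simps)
    then have "c (echar b 1 x) = h x"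
      using b by (simp add: c_def q_def)
    with p(2)[of "echar b 1 x"] show ?thesis by simp
  qed
  then show ?thesis using trig_poly_of_polynomial[OF p(1)] by blast
qed

section \<open>Parseval's identity on a period cell\<close>

text \<open>
  Completing the square: the distance from \<open>H\<close> to a trigonometric sum is least when the
  coefficients are the Fourier coefficients \<open>b c\<^sub>m\<close>. The choice \<open>d\<^sub>m = b c\<^sub>m\<close> gives Bessel's
  inequality, and any other approximation gives a lower bound for the Fourier sum.
\<close>

lemma integral_norm_diff_trig_sum:
  assumes b: "b > 0" and H: "L2 (cellM b) H" and F: "finite F"
  defines "c \<equiv> \<lambda>m. LINT x|cellM b. H x * cnj (echar b m x)"
  shows "(LINT x|cellM b. (cmod (H x - (\<Sum>m\<in>F. d m * echar b m x)))\<^sup>2) =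
    (LINT x|cellM b. (cmod (H x))\<^sup>2) - b * (\<Sum>m\<in>F. (cmod (c m))\<^sup>2)
      + (1/b) * (\<Sum>m\<in>F. (cmod (d m - complex_of_real b * c m))\<^sup>2)" (is "?L = ?R")
proof -
  define T where "T x = (\<Sum>m\<in>F. d m * echar b m x)" for x
  have T: "L2 (cellM b) T"
    unfolding T_def using F by (intro L2_sum L2_cmult L2_echar)
  have HT: "(LINT x|cellM b. H x * cnj (T x)) = (\<Sum>m\<in>F. cnj (d m) * c m)"
  proof -
    have "(LINT x|cellM b. H x * cnj (T x)) =
        (LINT x|cellM b. (\<Sum>m\<in>F. cnj (d m) * (H x * cnj (echar b m x))))"
      by (simp add: T_def sum_distrib_left mult_ac)
    also have "\<dots> = (\<Sum>m\<in>F. LINT x|cellM b. cnj (d m) * (H x * cnj (echar b m x)))"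
      by (intro Bochner_Integration.integral_sum integrable_mult_right L2_mult_integrable H L2_echar)
    finally show ?thesis by (simp add: c_def)
  qed
  have TH: "(LINT x|cellM b. T x * cnj (H x)) = (\<Sum>m\<in>F. d m * cnj (c m))"
  proof -
    have "(LINT x|cellM b. T x * cnj (H x)) = cnj (LINT x|cellM b. H x * cnj (T x))"
      unfolding Bochner_Integration.integral_cnj[symmetric] by (simp add: mult.commute)
    then show ?thesis by (simp add: HT)
  qed
  have TT: "(LINT x|cellM b. T x * cnj (T x)) = (\<Sum>m\<in>F. d m * cnj (d m)) / complex_of_real b"
  proof -
    have "(LINT x|cellM b. T x * cnj (T x)) =
        (LINT x|cellM b. (\<Sum>m\<in>F. \<Sum>l\<in>F. d m * cnj (d l) * echar b (m - l) x))"
      by (simp add: T_def sum_product cnj_echar mult_ac flip: echar_add)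
    also have "\<dots> = (\<Sum>m\<in>F. \<Sum>l\<in>F. d m * cnj (d l) * (LINT x|cellM b. echar b (m - l) x))"
      by (subst Bochner_Integration.integral_sum
          | intro Bochner_Integration.integrable_sum integrable_mult_right integrable_echar sum.cong refl
          | simp)+
    also have "\<dots> = (\<Sum>m\<in>F. d m * cnj (d m) / complex_of_real b)"
    proof (rule sum.cong[OF refl])
      fix m assume "m \<in> F"
      have "(\<Sum>l\<in>F. d m * cnj (d l) * (LINT x|cellM b. echar b (m - l) x)) =
          (\<Sum>l\<in>F. if l = m then d m * cnj (d m) / complex_of_real b else 0)"
        by (intro sum.cong) (auto simp: integral_echar[OF b])
      with \<open>m \<in> F\<close> F show "(\<Sum>l\<in>F. d m * cnj (d l) * (LINT x|cellM b. echar b (m - l) x)) =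
          d m * cnj (d m) / complex_of_real b" by simp
    qed
    finally show ?thesis by (simp add: sum_divide_distrib)
  qed
  have HH: "(LINT x|cellM b. H x * cnj (H x)) = complex_of_real (LINT x|cellM b. (cmod (H x))\<^sup>2)"
    unfolding integral_complex_of_real[symmetric] complex_norm_square ..
  \<comment> \<open>The integrals are computed over the complex numbers, where the square of a modulus is a product.\<close>
  have "complex_of_real ?L = (LINT x|cellM b. (H x - T x) * cnj (H x - T x))"
    unfolding integral_complex_of_real[symmetric] complex_norm_square T_def ..
  also have "\<dots> = (LINT x|cellM b. H x * cnj (H x) - H x * cnj (T x) - T x * cnj (H x) + T x * cnj (T x))"
    by (simp add: algebra_simps)
  also have "\<dots> = (LINT x|cellM b. H x * cnj (H x)) - (LINT x|cellM b. H x * cnj (T x))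
      - (LINT x|cellM b. T x * cnj (H x)) + (LINT x|cellM b. T x * cnj (T x))"
    using L2_mult_integrable[OF H H] L2_mult_integrable[OF H T] L2_mult_integrable[OF T H]
      L2_mult_integrable[OF T T] by simp
  also have "\<dots> = complex_of_real (LINT x|cellM b. (cmod (H x))\<^sup>2) - (\<Sum>m\<in>F. cnj (d m) * c m)
      - (\<Sum>m\<in>F. d m * cnj (c m)) + (\<Sum>m\<in>F. d m * cnj (d m)) / complex_of_real b"
    by (simp only: HH HT TH TT)
  also have "\<dots> = complex_of_real (LINT x|cellM b. (cmod (H x))\<^sup>2) +
     (\<Sum>m\<in>F. - (cnj (d m) * c m) - d m * cnj (c m) + d m * cnj (d m) / complex_of_real b)"
    by (simp add: sum.distrib sum_subtractf sum_negf sum_divide_distrib)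
  also have "(\<Sum>m\<in>F. - (cnj (d m) * c m) - d m * cnj (c m) + d m * cnj (d m) / complex_of_real b) =
     (\<Sum>m\<in>F. - (complex_of_real b * (c m * cnj (c m))) + (1 / complex_of_real b) *
        ((d m - complex_of_real b * c m) * cnj (d m - complex_of_real b * c m)))"
    using b by (intro sum.cong refl) (simp add: field_simps)
  also have "\<dots> = complex_of_real (- (b * (\<Sum>m\<in>F. (cmod (c m))\<^sup>2))
      + (1/b) * (\<Sum>m\<in>F. (cmod (d m - complex_of_real b * c m))\<^sup>2))"
    by (simp only: sum.distrib sum_negf sum_distrib_left[symmetric] complex_norm_square[symmetric])
      simp
  finally have "complex_of_real ?L = complex_of_real ?R" by simp
  then show ?thesis by (simp only: of_real_eq_iff)
qed

definition trig_approximable :: "real \<Rightarrow> (real \<Rightarrow> complex) \<Rightarrow> bool" where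
  "trig_approximable b H \<longleftrightarrow>
     L2 (cellM b) H \<and> (\<forall>e>0. \<exists>T. trig_poly b T \<and> (LINT x|cellM b. (cmod (H x - T x))\<^sup>2) < e)"

lemma trig_approximable_limit:
  assumes H: "L2 (cellM b) H" and h: "\<And>n. trig_approximable b (h n)"
    and lim: "(\<lambda>n. LINT x|cellM b. (cmod (H x - h n x))\<^sup>2) \<longlonglongrightarrow> 0"
  shows "trig_approximable b H"
  unfolding trig_approximable_def
proof (intro conjI allI impI H)
  fix e :: real assume e: "e > 0"
  have "\<forall>\<^sub>F n in sequentially. (LINT x|cellM b. (cmod (H x - h n x))\<^sup>2) < e / 4"
    using lim e by (intro order_tendstoD(2)[OF lim]) auto
  then obtain n where n: "(LINT x|cellM b. (cmod (H x - h n x))\<^sup>2) < e / 4"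
    by (auto simp: eventually_sequentially)
  obtain T where T: "trig_poly b T" "(LINT x|cellM b. (cmod (h n x - T x))\<^sup>2) < e / 4"
    using h[of n] e unfolding trig_approximable_def by (meson zero_less_divide_iff zero_less_numeral)
  have hn: "L2 (cellM b) (h n)" using h by (simp add: trig_approximable_def)
  note T2 = trig_poly_L2[OF T(1)]
  have i: "integrable (cellM b) (\<lambda>x. (cmod (H x - h n x))\<^sup>2)" "integrable (cellM b) (\<lambda>x. (cmod (h n x - T x))\<^sup>2)"
    "integrable (cellM b) (\<lambda>x. (cmod (H x - T x))\<^sup>2)"
    using L2_diff[OF H hn] L2_diff[OF hn T2] L2_diff[OF H T2] by (auto simp: L2_def)
  have "(LINT x|cellM b. (cmod (H x - T x))\<^sup>2) \<le>
      (LINT x|cellM b. 2 * ((cmod (H x - h n x))\<^sup>2 + (cmod (h n x - T x))\<^sup>2))"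
  proof (rule integral_mono)
    fix x
    show "(cmod (H x - T x))\<^sup>2 \<le> 2 * ((cmod (H x - h n x))\<^sup>2 + (cmod (h n x - T x))\<^sup>2)"
      using norm_add_squared_le[of "H x - h n x" "h n x - T x"] by simp
  qed (use i in auto)
  also have "\<dots> < e" using i n T(2) by simp
  finally show "\<exists>T. trig_poly b T \<and> (LINT x|cellM b. (cmod (H x - T x))\<^sup>2) < e"
    using T(1) by blast
qed

text \<open>
  On a cell of finite measure \<open>1/b\<close>, uniform approximation implies approximation in mean square.
\<close>

lemma trig_approximable_loop:
  assumes b: "b > 0" and cont: "continuous_on UNIV h" and loop: "h 0 = h (1/b)"
    and bnd: "\<And>x. cmod (h x) \<le> C"
  shows "trig_approximable b h"
proof -
  have "h \<in> borel_measurable lebesgue"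
    using borel_measurable_continuous_onI[OF cont] by (simp add: measurable_completion)
  then have meas: "h \<in> borel_measurable (cellM b)" by (rule measurable_restrict_space1)
  have h: "L2 (cellM b) h" by (rule L2_bounded[OF finite_measure_cell meas bnd])
  have "\<exists>T. trig_poly b T \<and> (LINT x|cellM b. (cmod (h x - T x))\<^sup>2) < e" if e: "e > 0" for e
  proof -
    define r where "r = sqrt (e * b / 2)"
    have r: "r > 0" using e b by (simp add: r_def)
    obtain T where T: "trig_poly b T" "\<And>x. x \<in> cell b \<Longrightarrow> cmod (h x - T x) < r"
      using loop_trig_poly_approx[OF b continuous_on_subset[OF cont] loop r] by auto
    have "(LINT x|cellM b. (cmod (h x - T x))\<^sup>2) \<le> (LINT x|cellM b. r\<^sup>2)"
    proof (rule integral_mono)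
      show "integrable (cellM b) (\<lambda>x. (cmod (h x - T x))\<^sup>2)"
        using L2_diff[OF h trig_poly_L2[OF T(1)]] by (simp add: L2_def)
      show "integrable (cellM b) (\<lambda>x. r\<^sup>2)"
        using finite_measure_cell by (simp add: finite_measure.integrable_const)
      show "(cmod (h x - T x))\<^sup>2 \<le> r\<^sup>2" if "x \<in> space (cellM b)" for x
        using T(2)[of x] that by (intro power_mono) (auto simp: space_restrict_space intro: less_imp_le)
    qed
    also have "\<dots> = e / 2"
      using e b by (simp add: measure_restrict_space r_def)
    also have "\<dots> < e" using e by simp
    finally show ?thesis using T(1) by blast
  qed
  then show ?thesis using h by (simp add: trig_approximable_def)
qed

text \<open>
  The radial retraction of the plane onto the closed disc of radius \<open>C\<close>; it is continuous and hence
  keeps continuous approximants continuous while making them uniformly bounded.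
\<close>

definition clip :: "real \<Rightarrow> complex \<Rightarrow> complex" where
  "clip C z = complex_of_real (C / max C (cmod z)) * z"

lemma norm_clip_le: "C > 0 \<Longrightarrow> cmod (clip C z) \<le> C"
  by (auto simp: clip_def norm_mult norm_divide max_def)

lemma clip_eq: "C > 0 \<Longrightarrow> cmod z \<le> C \<Longrightarrow> clip C z = z"
  by (simp add: clip_def max_def)

lemma continuous_on_clip: "C > 0 \<Longrightarrow> continuous_on S (clip C)"
  unfolding clip_def by (intro continuous_intros) (auto simp: max_def)

text \<open>
  A measurable function is almost everywhere a limit of continuous functions. Clipping these
  to the bound of \<open>H\<close> makes dominated convergence applicable, and a cutoff vanishing at both end
  points of the cell turns them into loops.
\<close>

lemma trig_approximable_bounded:
  assumes b: "b > 0" and H: "H \<in> borel_measurable lebesgue" and bnd: "\<And>x. cmod (H x) \<le> C"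
  shows "trig_approximable b H"
proof -
  define D where "D = max C 1"
  have D: "D > 0" "\<And>x. cmod (H x) \<le> D"
    using bnd by (auto simp: D_def intro: order_trans[OF bnd])
  have Hc: "H \<in> borel_measurable (cellM b)" using H by (rule measurable_restrict_space1)
  have L2H: "L2 (cellM b) H"
    by (rule L2_bounded[OF finite_measure_cell Hc bnd])
  have "H measurable_on UNIV"
    using lebesgue_measurable_imp_measurable_on[OF H] by simp
  then obtain N g where N: "negligible N" and g: "\<And>n. continuous_on UNIV (g n)"
    and lim: "\<And>x. x \<notin> N \<Longrightarrow> (\<lambda>n. g n x) \<longlonglongrightarrow> H x"
    by (auto simp: measurable_on_def)
  \<comment> \<open>The cutoff vanishes at \<open>0\<close> and \<open>1/b\<close> and is eventually \<open>1\<close> at every other point.\<close>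
  define \<phi> :: "nat \<Rightarrow> real \<Rightarrow> real" where "\<phi> n x = min 1 (real n * \<bar>x * (1/b - x)\<bar>)" for n x
  define h where "h n x = complex_of_real (\<phi> n x) * clip D (g n x)" for n x
  have h_bnd: "cmod (h n x) \<le> D" for n x
  proof -
    have "cmod (h n x) \<le> 1 * D"
      unfolding h_def norm_mult by (intro mult_mono norm_clip_le D) (auto simp: \<phi>_def)
    then show ?thesis by simp
  qed
  have h_cont: "continuous_on UNIV (h n)" for n
    unfolding h_def \<phi>_def
    by (intro continuous_intros continuous_on_compose2[OF continuous_on_clip[OF D(1), of UNIV] g]) auto
  have h_approx: "trig_approximable b (h n)" for n
    by (rule trig_approximable_loop[OF b h_cont _ h_bnd]) (simp add: h_def \<phi>_def)
  have h_lim: "(\<lambda>n. h n x) \<longlonglongrightarrow> H x" if "x \<notin> N" "x \<noteq> 0" "x \<noteq> 1/b" for x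
  proof -
    have pos: "\<bar>x * (1/b - x)\<bar> > 0" using that by auto
    obtain n0 where n0: "1 < real n0 * \<bar>x * (1/b - x)\<bar>"
      using reals_Archimedean3[OF pos] by blast
    have "\<phi> n x = 1" if "n \<ge> n0" for n
    proof -
      have "real n0 * \<bar>x * (1/b - x)\<bar> \<le> real n * \<bar>x * (1/b - x)\<bar>"
        using that by (intro mult_right_mono) auto
      with n0 show ?thesis by (simp add: \<phi>_def)
    qed
    then have "\<forall>\<^sub>F n in sequentially. \<phi> n x = 1"
      by (auto simp: eventually_sequentially)
    then have "(\<lambda>n. \<phi> n x) \<longlonglongrightarrow> 1" by (rule tendsto_eventually)
    moreover have "(\<lambda>n. clip D (g n x)) \<longlonglongrightarrow> clip D (H x)"
      using continuous_on_clip[OF D(1), of UNIV] lim[OF that(1)]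
      by (intro isCont_tendsto_compose[where g = "clip D"]) (auto simp: continuous_on_eq_continuous_at)
    ultimately have "(\<lambda>n. h n x) \<longlonglongrightarrow> complex_of_real 1 * clip D (H x)"
      unfolding h_def by (intro tendsto_intros)
    then show ?thesis by (simp add: clip_eq D)
  qed
  show ?thesis
  proof (rule trig_approximable_limit[OF L2H h_approx])
    show "(\<lambda>n. LINT x|cellM b. (cmod (H x - h n x))\<^sup>2) \<longlonglongrightarrow> 0"
    proof (rule L2_dominated_convergence[OF L2H])
      show "h n \<in> borel_measurable (cellM b)" for n
        using h_approx[of n] by (simp add: trig_approximable_def L2_def)
      show "integrable (cellM b) (\<lambda>x. D\<^sup>2)"
        using finite_measure_cell by (simp add: finite_measure.integrable_const)
      show "AE x in cellM b. cmod (h n x) \<le> D" for n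
        using h_bnd by simp
      have "negligible (N \<union> {0, 1/b})" using N by simp
      then have "N \<union> {0, 1/b} \<in> null_sets lebesgue" by (simp add: negligible_iff_null_sets)
      then have "AE x in lebesgue. x \<notin> N \<union> {0, 1/b}" by (rule AE_not_in)
      then have "AE x in lebesgue. x \<in> cell b \<longrightarrow> (\<lambda>n. h n x) \<longlonglongrightarrow> H x"
        by eventually_elim (auto intro: h_lim)
      then show "AE x in cellM b. (\<lambda>n. h n x) \<longlonglongrightarrow> H x"
        by (subst AE_restrict_space_iff) auto
    qed
  qed
qed

lemma trig_approximable_L2:
  assumes b: "b > 0" and H: "H \<in> borel_measurable lebesgue" and L2H: "L2 (cellM b) H"
  shows "trig_approximable b H"
proof -
  define h where "h n x = (if cmod (H x) \<le> real n then H x else 0)" for n x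
  have meas: "h n \<in> borel_measurable lebesgue" for n
    unfolding h_def using H by measurable
  have h_approx: "trig_approximable b (h n)" for n
    by (rule trig_approximable_bounded[OF b meas, of _ "real n"]) (auto simp: h_def)
  have h_lim: "(\<lambda>n. h n x) \<longlonglongrightarrow> H x" for x
  proof (rule tendsto_eventually)
    obtain n0 where "cmod (H x) \<le> real n0" using real_arch_simple by blast
    then show "\<forall>\<^sub>F n in sequentially. h n x = H x"
      by (auto simp: h_def eventually_sequentially intro!: exI[of _ n0])
  qed
  show ?thesis
  proof (rule trig_approximable_limit[OF L2H h_approx])
    show "(\<lambda>n. LINT x|cellM b. (cmod (H x - h n x))\<^sup>2) \<longlonglongrightarrow> 0"
    proof (rule L2_dominated_convergence[OF L2H])
      show "h n \<in> borel_measurable (cellM b)" for n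
        using meas by (rule measurable_restrict_space1)
      show "integrable (cellM b) (\<lambda>x. (cmod (H x))\<^sup>2)" using L2H by (simp add: L2_def)
      show "AE x in cellM b. cmod (h n x) \<le> cmod (H x)" for n
        by (auto simp: h_def)
      show "AE x in cellM b. (\<lambda>n. h n x) \<longlonglongrightarrow> H x"
        using h_lim by simp
    qed
  qed
qed

theorem parseval_cell:
  assumes b: "b > 0" and H: "H \<in> borel_measurable lebesgue" and L2H: "L2 (cellM b) H"
  shows "((\<lambda>m. (cmod (LINT x|cellM b. H x * cnj (echar b m x)))\<^sup>2) has_sum
           (1/b) * (LINT x|cellM b. (cmod (H x))\<^sup>2)) UNIV"
proof -
  define c where "c m = (LINT x|cellM b. H x * cnj (echar b m x))" for m
  define I where "I = (LINT x|cellM b. (cmod (H x))\<^sup>2)"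
  have upper: "b * (\<Sum>m\<in>F. (cmod (c m))\<^sup>2) \<le> I" if "finite F" for F
  proof -
    have "0 \<le> (LINT x|cellM b. (cmod (H x - (\<Sum>m\<in>F. complex_of_real b * c m * echar b m x)))\<^sup>2)"
      by (rule Bochner_Integration.integral_nonneg) simp
    also have "\<dots> = I - b * (\<Sum>m\<in>F. (cmod (c m))\<^sup>2)"
      by (subst integral_norm_diff_trig_sum[OF b L2H that]) (simp add: I_def c_def)
    finally show ?thesis by simp
  qed
  have lower: "\<exists>F. finite F \<and> I - e < b * (\<Sum>m\<in>F. (cmod (c m))\<^sup>2)" if e: "e > 0" for e
  proof -
    obtain T where T: "trig_poly b T" "(LINT x|cellM b. (cmod (H x - T x))\<^sup>2) < e"
      using trig_approximable_L2[OF b H L2H] e by (auto simp: trig_approximable_def)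
    obtain F d where F: "finite F" and Td: "T = (\<lambda>x. \<Sum>m\<in>F. d m * echar b m x)"
      using trig_poly_finite_sum[OF T(1)] by blast
    have "(LINT x|cellM b. (cmod (H x - T x))\<^sup>2) = I - b * (\<Sum>m\<in>F. (cmod (c m))\<^sup>2)
      + (1/b) * (\<Sum>m\<in>F. (cmod (d m - complex_of_real b * c m))\<^sup>2)"
      unfolding Td by (subst integral_norm_diff_trig_sum[OF b L2H F]) (simp add: I_def c_def)
    moreover have "0 \<le> (1/b) * (\<Sum>m\<in>F. (cmod (d m - complex_of_real b * c m))\<^sup>2)"
      using b by (simp add: sum_nonneg)
    ultimately show ?thesis using T(2) F by (intro exI[of _ F]) auto
  qed
  have "((\<lambda>m. (cmod (c m))\<^sup>2) has_sum (1/b) * I) UNIV"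
    unfolding has_sum_def
  proof (rule order_tendstoI)
    fix y assume y: "y < (1/b) * I"
    then have "I - b * y > 0" using b by (simp add: field_simps)
    from lower[OF this] obtain F where F: "finite F" "b * y < b * (\<Sum>m\<in>F. (cmod (c m))\<^sup>2)"
      by auto
    have "y < (\<Sum>m\<in>F'. (cmod (c m))\<^sup>2)" if "finite F'" "F \<subseteq> F'" for F'
      using F b sum_mono2[OF that, of "\<lambda>m. (cmod (c m))\<^sup>2"] by auto
    then show "\<forall>\<^sub>F F in finite_subsets_at_top UNIV. y < (\<Sum>m\<in>F. (cmod (c m))\<^sup>2)"
      using F(1) by (auto simp: eventually_finite_subsets_at_top intro!: exI[of _ F])
  next
    fix y assume y: "y > (1/b) * I"
    have "(\<Sum>m\<in>F. (cmod (c m))\<^sup>2) < y" if "finite F" for F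
    proof -
      have "(\<Sum>m\<in>F. (cmod (c m))\<^sup>2) \<le> (1/b) * I" using upper[OF that] b by (simp add: field_simps)
      with y show ?thesis by simp
    qed
    then show "\<forall>\<^sub>F F in finite_subsets_at_top UNIV. (\<Sum>m\<in>F. (cmod (c m))\<^sup>2) < y"
      by (auto simp: eventually_finite_subsets_at_top)
  qed
  then show ?thesis by (simp add: c_def I_def)
qed

section \<open>Translations, and integrals as sums over period cells\<close>

lemma measurable_lebesgue_shift:
  assumes "f \<in> borel_measurable lebesgue"
  shows "(\<lambda>x::real. f (x + c)) \<in> borel_measurable lebesgue"
proof -
  have "(\<lambda>x. c + 1 * x) \<in> lebesgue \<rightarrow>\<^sub>M lebesgue"
    using lebesgue_affine_measurable[where c = "\<lambda>x::real. 1" and t = c] by simp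
  from measurable_compose[OF this assms] show ?thesis by (simp add: add.commute)
qed

lemma integrable_lebesgue_shift:
  fixes f :: "real \<Rightarrow> 'a :: euclidean_space"
  shows "integrable lebesgue (\<lambda>x. f (x + c)) \<longleftrightarrow> integrable lebesgue f"
  using lebesgue_integrable_real_affine_iff[of 1 f c] by (simp add: add.commute)

lemma integral_lebesgue_shift:
  fixes f :: "real \<Rightarrow> 'a :: euclidean_space"
  shows "(LINT x|lebesgue. f (x + c)) = (LINT x|lebesgue. f x)"
  using lebesgue_integral_real_affine[of 1 f c] by (simp add: add.commute)

lemma AE_lebesgue_shift:
  assumes "AE x::real in lebesgue. P x"
  shows "AE x in lebesgue. P (x + c)"
proof -
  have "negligible {x. \<not> P x}"
    using assms by (simp add: completion.AE_iff_null_sets negligible_iff_null_sets)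
  then have "negligible ((+) (- c) ` {x. \<not> P x})" by (rule negligible_translation)
  also have "(+) (- c) ` {x. \<not> P x} = {x. \<not> P (x + c)}"
    by (auto intro!: image_eqI[where x = "_ + c"])
  finally show ?thesis
    by (simp add: completion.AE_iff_null_sets negligible_iff_null_sets)
qed

lemma L2_shift: "L2 lebesgue f \<Longrightarrow> L2 lebesgue (\<lambda>x::real. f (x + c))"
  unfolding L2_def
  using measurable_lebesgue_shift[of f c] integrable_lebesgue_shift[of "\<lambda>x. (cmod (f x))\<^sup>2" c] by auto

lemma integrable_cell:
  fixes f :: "real \<Rightarrow> 'a :: {banach, second_countable_topology}"
  assumes "integrable lebesgue f"
  shows "integrable (cellM b) f"
  using integrable_mult_indicator[of "cell b" lebesgue f] assms
  by (subst integrable_restrict_space) auto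

lemma L2_cell: "L2 lebesgue f \<Longrightarrow> L2 (cellM b) f"
  unfolding L2_def by (auto intro: integrable_cell measurable_restrict_space1)

text \<open>
  The cell of index \<open>j\<close> consists of the points \<open>t\<close> with \<open>\<lfloor>b t\<rfloor> = j\<close>, so bounded support can be
  expressed by letting \<open>\<lfloor>b t\<rfloor>\<close> range over a finite set.
\<close>

lemma integral_sum_cells:
  fixes u :: "real \<Rightarrow> complex"
  assumes b: "b > 0" and u: "integrable lebesgue u" and K: "finite K" "\<And>t. u t \<noteq> 0 \<Longrightarrow> \<lfloor>b * t\<rfloor> \<in> K"
  shows "(LINT t|lebesgue. u t) = (\<Sum>j\<in>K. LINT x|cellM b. u (x + of_int j / b))"
proof -
  have ind: "indicator (cell b) (t - of_int j / b) = (if \<lfloor>b * t\<rfloor> = j then 1 else 0 :: real)" for t j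
  proof -
    have "t - of_int j / b = (b * t - of_int j) / b"
      using b by (simp add: field_simps)
    then have "t - of_int j / b \<in> cell b \<longleftrightarrow> of_int j \<le> b * t \<and> b * t < of_int j + 1"
      using b by (auto simp: zero_le_divide_iff divide_less_cancel)
    also have "\<dots> \<longleftrightarrow> \<lfloor>b * t\<rfloor> = j" by linarith
    finally show ?thesis by (simp add: indicator_def)
  qed
  have ind_int: "integrable lebesgue (\<lambda>x. indicator (cell b) x *\<^sub>R u (x + of_int j / b))" for j
    using u by (intro integrable_mult_indicator) (auto simp: integrable_lebesgue_shift[of u])
  have int: "integrable lebesgue (\<lambda>t. indicator (cell b) (t - of_int j / b) *\<^sub>R u t)" for j
    using ind_int[of j]
      integrable_lebesgue_shift[of "\<lambda>t. indicator (cell b) (t - of_int j / b) *\<^sub>R u t" "of_int j / b"]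
    by simp
  have "u t = (\<Sum>j\<in>K. indicator (cell b) (t - of_int j / b) *\<^sub>R u t)" for t
    using K by (cases "u t = 0") (auto simp: ind if_distrib[of "\<lambda>c. c *\<^sub>R u t"] cong: if_cong)
  then have "(LINT t|lebesgue. u t) = (LINT t|lebesgue. (\<Sum>j\<in>K. indicator (cell b) (t - of_int j / b) *\<^sub>R u t))"
    by simp
  also have "\<dots> = (\<Sum>j\<in>K. LINT t|lebesgue. indicator (cell b) (t - of_int j / b) *\<^sub>R u t)"
    by (rule Bochner_Integration.integral_sum[OF int])
  also have "\<dots> = (\<Sum>j\<in>K. LINT x|cellM b. u (x + of_int j / b))"
  proof (rule sum.cong[OF refl])
    fix j
    have "(LINT x|cellM b. u (x + of_int j / b)) = (LINT x|lebesgue. indicator (cell b) x *\<^sub>R u (x + of_int j / b))"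
      by (rule integral_restrict_space) simp
    also have "\<dots> = (LINT t|lebesgue. indicator (cell b) (t - of_int j / b) *\<^sub>R u t)"
      using integral_lebesgue_shift[of "\<lambda>t. indicator (cell b) (t - of_int j / b) *\<^sub>R u t" "of_int j / b"]
      by simp
    finally show "(LINT t|lebesgue. indicator (cell b) (t - of_int j / b) *\<^sub>R u t) =
      (LINT x|cellM b. u (x + of_int j / b))" ..
  qed
  finally show ?thesis .
qed

lemma floor_cell:
  assumes "b > 0" "x \<in> cell b"
  shows "\<lfloor>b * (x + of_int j / b)\<rfloor> = j"
proof -
  have "b * (x + of_int j / b) = b * x + of_int j" using assms by (simp add: field_simps)
  moreover have "0 \<le> b * x" "b * x < 1" using assms by (auto simp: field_simps)
  ultimately show ?thesis by linarith
qed

lemma L2_bounded_support_integrable: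
  fixes f :: "real \<Rightarrow> complex"
  assumes f: "L2 lebesgue f" and b: "b > 0" and K: "finite K" "\<And>t. f t \<noteq> 0 \<Longrightarrow> \<lfloor>b * t\<rfloor> \<in> K"
  shows "integrable lebesgue f"
proof (cases "K = {}")
  case True
  then have "f = (\<lambda>_. 0)" using K by auto
  then show ?thesis by simp
next
  case False
  define S where "S = {of_int (Min K) / b .. (of_int (Max K) + 1) / b}"
  have S: "t \<in> S" if "f t \<noteq> 0" for t
  proof -
    have "Min K \<le> \<lfloor>b * t\<rfloor>" "\<lfloor>b * t\<rfloor> \<le> Max K" using K that by auto
    then have "of_int (Min K) \<le> b * t" "b * t \<le> of_int (Max K) + 1" by linarith+
    then show ?thesis using b by (auto simp: S_def field_simps)
  qed
  show ?thesis
  proof (rule Bochner_Integration.integrable_bound)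
    have "S \<in> lmeasurable" by (simp add: S_def)
    then show "integrable lebesgue (\<lambda>x. (cmod (f x))\<^sup>2 + indicator S x)"
      using f by (auto simp: L2_def lmeasurable_iff_integrable)
    show "AE x in lebesgue. cmod (f x) \<le> norm ((cmod (f x))\<^sup>2 + indicator S x)"
    proof (rule AE_I2)
      fix x
      show "cmod (f x) \<le> norm ((cmod (f x))\<^sup>2 + indicator S x)"
        using S[of x] mult_le_sum_squares[of "cmod (f x)" 1] by (cases "f x = 0") auto
    qed
  qed (use f in \<open>simp add: L2_def\<close>)
qed

text \<open>
  The characters have period \<open>1/b\<close>, so the coefficients of \<open>h\<close> on the line are those of its
  periodization \<open>H\<close> on one cell. Multiplying out the norm of \<open>H\<close> gives a double sum of
  correlations of pieces of \<open>h\<close>; ordered by the difference of the two indices, it is the sum of the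
  autocorrelations of \<open>h\<close> on the line. Indices lie in \<open>{-N..N}\<close>, so differences lie in
  \<open>{-2N..2N}\<close>.
\<close>

theorem parseval_bounded_support:
  assumes b: "b > 0" and h: "L2 lebesgue h" and K: "\<And>t. h t \<noteq> 0 \<Longrightarrow> \<lfloor>b * t\<rfloor> \<in> {- N..N}"
  shows "((\<lambda>m. complex_of_real ((cmod (LINT t|lebesgue. h t * cnj (echar b m t)))\<^sup>2)) has_sum
      1 / complex_of_real b * (\<Sum>k\<in>{- 2 * N..2 * N}. LINT t|lebesgue. cnj (h t) * h (t - of_int k / b))) UNIV"
proof -
  define H where "H x = (\<Sum>j\<in>{- N..N}. h (x + of_int j / b))" for x
  define I where "I j l = (LINT x|cellM b. cnj (h (x + of_int j / b)) * h (x + of_int l / b))" for j l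
  have hs: "L2 (cellM b) (\<lambda>x. h (x + of_int j / b))" for j
    by (intro L2_cell L2_shift h)
  have h_int: "integrable lebesgue h"
    by (rule L2_bounded_support_integrable[OF h b _ K]) auto
  have H_meas: "H \<in> borel_measurable lebesgue"
    unfolding H_def using h by (intro borel_measurable_sum measurable_lebesgue_shift) (simp add: L2_def)
  have H_L2: "L2 (cellM b) H"
    unfolding H_def by (rule L2_sum[OF _ hs]) simp
  have coeff: "(LINT t|lebesgue. h t * cnj (echar b m t)) = (LINT x|cellM b. H x * cnj (echar b m x))" for m
  proof -
    have "integrable lebesgue (\<lambda>t. h t * cnj (echar b m t))"
      by (rule Bochner_Integration.integrable_bound[OF h_int])
        (use h in \<open>auto simp: norm_mult L2_def\<close>)
    then have "(LINT t|lebesgue. h t * cnj (echar b m t)) =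
      (\<Sum>j\<in>{- N..N}. LINT x|cellM b. h (x + of_int j / b) * cnj (echar b m (x + of_int j / b)))"
      by (rule integral_sum_cells[OF b]) (use K in auto)
    also have "\<dots> = (\<Sum>j\<in>{- N..N}. LINT x|cellM b. h (x + of_int j / b) * cnj (echar b m x))"
      by (simp add: echar_shift[OF b])
    also have "\<dots> = (LINT x|cellM b. H x * cnj (echar b m x))"
      unfolding H_def sum_distrib_right
      by (subst Bochner_Integration.integral_sum) (auto intro: L2_mult_integrable hs L2_echar)
    finally show ?thesis .
  qed
  have I_int: "integrable (cellM b) (\<lambda>x. cnj (h (x + of_int j / b)) * h (x + of_int l / b))" for j l
    using L2_mult_integrable[OF hs hs, of l j] by (simp add: mult.commute)
  have "complex_of_real (LINT x|cellM b. (cmod (H x))\<^sup>2) = (LINT x|cellM b. cnj (H x) * H x)"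
    unfolding integral_complex_of_real[symmetric] complex_norm_square by (simp add: mult.commute)
  also have "\<dots> = (\<Sum>j\<in>{- N..N}. \<Sum>l\<in>{- N..N}. I j l)"
    unfolding H_def I_def cnj_sum sum_product
    by (subst Bochner_Integration.integral_sum
        | intro Bochner_Integration.integrable_sum I_int sum.cong refl)+
  finally have norm_H: "complex_of_real (LINT x|cellM b. (cmod (H x))\<^sup>2) = (\<Sum>j\<in>{- N..N}. \<Sum>l\<in>{- N..N}. I j l)" .
  have I_zero: "I j l = 0" if "l \<notin> {- N..N}" for j l
  proof -
    have "I j l = (LINT x|cellM b. 0)"
      unfolding I_def
    proof (rule Bochner_Integration.integral_cong[OF refl])
      fix x assume "x \<in> space (cellM b)"
      then have "x \<in> cell b" by (simp add: space_restrict_space)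
      then have "h (x + of_int l / b) = 0" using K[of "x + of_int l / b"] floor_cell[OF b] that by metis
      then show "cnj (h (x + of_int j / b)) * h (x + of_int l / b) = 0" by simp
    qed
    then show ?thesis by simp
  qed
  have corr: "(LINT t|lebesgue. cnj (h t) * h (t - of_int k / b)) = (\<Sum>j\<in>{- N..N}. I j (j - k))" for k
  proof -
    have "integrable lebesgue (\<lambda>t. cnj (h t) * h (t - of_int k / b))"
      using L2_mult_integrable[OF L2_shift[OF h, of "- of_int k / b"] h] by (simp add: mult.commute)
    then have "(LINT t|lebesgue. cnj (h t) * h (t - of_int k / b)) =
      (\<Sum>j\<in>{- N..N}. LINT x|cellM b. cnj (h (x + of_int j / b)) * h (x + of_int j / b - of_int k / b))"
      by (rule integral_sum_cells[OF b]) (use K in auto)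
    also have "\<dots> = (\<Sum>j\<in>{- N..N}. I j (j - k))"
      by (simp add: I_def diff_divide_distrib add_diff_eq)
    finally show ?thesis .
  qed
  have "(\<Sum>k\<in>{- 2 * N..2 * N}. LINT t|lebesgue. cnj (h t) * h (t - of_int k / b)) =
      (\<Sum>j\<in>{- N..N}. \<Sum>k\<in>{- 2 * N..2 * N}. I j (j - k))"
    unfolding corr by (rule sum.swap)
  also have "\<dots> = (\<Sum>j\<in>{- N..N}. \<Sum>l\<in>{- N..N}. I j l)"
  proof (rule sum.cong[OF refl])
    fix j assume j: "j \<in> {- N..N}"
    have "(\<Sum>k\<in>{- 2 * N..2 * N}. I j (j - k)) = (\<Sum>l\<in>{j - 2 * N..j + 2 * N}. I j l)"
      by (rule sum.reindex_bij_witness[of _ "\<lambda>l. j - l" "\<lambda>k. j - k"]) auto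
    also have "\<dots> = (\<Sum>l\<in>{- N..N}. I j l)"
      using j I_zero by (intro sum.mono_neutral_right) auto
    finally show "(\<Sum>k\<in>{- 2 * N..2 * N}. I j (j - k)) = (\<Sum>l\<in>{- N..N}. I j l)" .
  qed
  finally have total: "(\<Sum>k\<in>{- 2 * N..2 * N}. LINT t|lebesgue. cnj (h t) * h (t - of_int k / b)) =
      complex_of_real (LINT x|cellM b. (cmod (H x))\<^sup>2)" by (simp add: norm_H)
  have "((\<lambda>m. complex_of_real ((cmod (LINT t|lebesgue. h t * cnj (echar b m t)))\<^sup>2)) has_sum
      complex_of_real ((1/b) * (LINT x|cellM b. (cmod (H x))\<^sup>2))) UNIV"
    unfolding coeff by (rule has_sum_of_real[OF parseval_cell[OF b H_meas H_L2]])
  then show ?thesis unfolding total by simp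
qed

section \<open>Summation over the integers under the integral\<close>

text \<open>
  Dominated convergence for unconditional sums, by enumerating the integers. The infinite sum takes
  the value \<open>0\<close> where it diverges, so its measurability is obtained from the completeness of Lebesgue
  measure.
\<close>

lemma
  fixes u :: "int \<Rightarrow> real \<Rightarrow> complex"
  assumes int: "\<And>n. integrable lebesgue (u n)" and w: "integrable lebesgue w"
    and bnd: "AE t in lebesgue. (\<lambda>n. cmod (u n t)) summable_on UNIV \<and> (\<Sum>\<^sub>\<infinity>n. cmod (u n t)) \<le> w t"
  shows integrable_infsum_int: "integrable lebesgue (\<lambda>t. \<Sum>\<^sub>\<infinity>n. u n t)"
    and has_sum_integral_int: "((\<lambda>n. LINT t|lebesgue. u n t) has_sum (LINT t|lebesgue. (\<Sum>\<^sub>\<infinity>n. u n t))) UNIV"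
proof -
  define v where "v i = u (int_decode i)" for i
  have bij: "bij_betw int_decode UNIV UNIV" by (rule bij_int_decode)
  have v_int: "integrable lebesgue (v i)" for i using int by (simp add: v_def)
  have pointwise: "summable (\<lambda>i. cmod (v i t)) \<and> (\<Sum>i<n. cmod (v i t)) \<le> w t \<and> (\<Sum>i. v i t) = (\<Sum>\<^sub>\<infinity>n. u n t)"
    if t: "(\<lambda>n. cmod (u n t)) summable_on UNIV" "(\<Sum>\<^sub>\<infinity>n. cmod (u n t)) \<le> w t" for t n
  proof -
    have 1: "(\<lambda>i. cmod (v i t)) summable_on UNIV"
      unfolding v_def using t(1) summable_on_reindex_bij_betw[OF bij, of "\<lambda>n. cmod (u n t)"] by simp
    have 2: "(\<Sum>\<^sub>\<infinity>i. cmod (v i t)) = (\<Sum>\<^sub>\<infinity>n. cmod (u n t))"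
      unfolding v_def by (rule infsum_reindex_bij_betw[OF bij])
    have 3: "(\<Sum>i<n. cmod (v i t)) \<le> w t"
      using finite_sum_le_infsum[OF 1, of "{..<n}"] 2 t(2) by auto
    have "(\<lambda>i. v i t) summable_on UNIV" by (rule abs_summable_summable[OF 1])
    then have "(\<lambda>i. v i t) sums (\<Sum>\<^sub>\<infinity>i. v i t)" by (simp add: has_sum_imp_sums)
    then have "(\<Sum>i. v i t) = (\<Sum>\<^sub>\<infinity>i. v i t)" by (simp add: sums_iff)
    also have "\<dots> = (\<Sum>\<^sub>\<infinity>n. u n t)"
      unfolding v_def by (rule infsum_reindex_bij_betw[OF bij])
    finally show ?thesis using 1 3 summable_on_imp_summable by blast
  qed
  have sm: "AE t in lebesgue. summable (\<lambda>i. cmod (v i t))"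
    and eq: "AE t in lebesgue. (\<Sum>i. v i t) = (\<Sum>\<^sub>\<infinity>n. u n t)"
    and part: "\<And>n. AE t in lebesgue. (\<Sum>i<n. cmod (v i t)) \<le> w t"
    using bnd by (eventually_elim, use pointwise in blast)+
  have norms: "(\<Sum>i<n. LINT t|lebesgue. cmod (v i t)) \<le> (LINT t|lebesgue. w t)" for n
  proof -
    have "(\<Sum>i<n. LINT t|lebesgue. cmod (v i t)) = (LINT t|lebesgue. (\<Sum>i<n. cmod (v i t)))"
      using v_int by simp
    also have "\<dots> \<le> (LINT t|lebesgue. w t)"
      using v_int w part by (intro integral_mono_AE) auto
    finally show ?thesis .
  qed
  have sums: "summable (\<lambda>i. LINT t|lebesgue. cmod (v i t))"
    by (rule summableI_nonneg_bounded[OF _ norms]) simp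
  note si = integrable_suminf[OF v_int sm sums] sums_integral[OF v_int sm sums]
  have meas: "(\<lambda>t. \<Sum>\<^sub>\<infinity>n. u n t) \<in> borel_measurable lebesgue"
    by (rule borel_measurable_AE[OF borel_measurable_integrable[OF si(1)] eq])
  show "integrable lebesgue (\<lambda>t. \<Sum>\<^sub>\<infinity>n. u n t)"
    by (rule integrable_cong_AE_imp[OF si(1) meas eq])
  have int_eq: "(LINT t|lebesgue. (\<Sum>i. v i t)) = (LINT t|lebesgue. (\<Sum>\<^sub>\<infinity>n. u n t))"
    using si(1) meas eq by (intro integral_cong_AE) auto
  have "summable (\<lambda>i. cmod (LINT t|lebesgue. v i t))"
    by (rule summable_comparison_test'[OF sums, of 0]) simp
  from norm_summable_imp_has_sum[OF this si(2)[unfolded int_eq]]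
  show "((\<lambda>n. LINT t|lebesgue. u n t) has_sum (LINT t|lebesgue. (\<Sum>\<^sub>\<infinity>n. u n t))) UNIV"
    unfolding v_def by (subst (asm) has_sum_reindex_bij_betw[OF bij, of "\<lambda>n. LINT t|lebesgue. u n t"])
qed

section \<open>Bounded orbit sums imply the identity\<close>

lemma WH_atom_eq: "WH_atom g a b m n x = echar b m x * g (x - of_int n * a)"
  by (simp add: WH_atom_def modulation_def translation_def echar_def)

definition orbit_bound :: "(real \<Rightarrow> complex) \<Rightarrow> real \<Rightarrow> real \<Rightarrow> real \<Rightarrow> bool" where
  "orbit_bound g a B t \<longleftrightarrow> (\<lambda>n::int. (cmod (g (t - of_int n * a)))\<^sup>2) summable_on UNIV \<and>
            (\<Sum>\<^sub>\<infinity>n::int. (cmod (g (t - of_int n * a)))\<^sup>2) \<le> B"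

lemma orbit_bound_term:
  assumes "orbit_bound g a B t"
  shows "(cmod (g (t - of_int n * a)))\<^sup>2 \<le> B"
  using finite_sum_le_infsum[of "\<lambda>n::int. (cmod (g (t - of_int n * a)))\<^sup>2" UNIV "{n}"] assms
  by (auto simp: orbit_bound_def)

text \<open>
  Instead of the Cauchy--Schwarz inequality, \<open>2xy \<le> x\<^sup>2 + y\<^sup>2\<close> suffices, because the same bound \<open>B\<close>
  holds for both factors.
\<close>

lemma orbit_bound_G_term:
  assumes "orbit_bound g a B t" "orbit_bound g a B (t - of_int k / b)"
  shows "(\<lambda>n. cmod (G_term g a b k t n)) summable_on UNIV \<and> (\<Sum>\<^sub>\<infinity>n. cmod (G_term g a b k t n)) \<le> B"
proof -
  define x where "x n = (cmod (g (t - of_int n * a)))\<^sup>2" for n :: int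
  define y where "y n = (cmod (g (t - of_int k / b - of_int n * a)))\<^sup>2" for n :: int
  have x: "x summable_on UNIV" "infsum x UNIV \<le> B" and y: "y summable_on UNIV" "infsum y UNIV \<le> B"
    using assms by (auto simp: orbit_bound_def x_def[abs_def] y_def[abs_def])
  have shift: "t - of_int k / b - of_int n * a = t - of_int n * a - of_int k / b" for n
    by simp
  have le: "cmod (G_term g a b k t n) \<le> (1/2) * (x n + y n)" for n
    using sum_squares_bound[of "cmod (g (t - of_int n * a))" "cmod (g (t - of_int n * a - of_int k / b))"]
    by (simp add: G_term_def norm_mult x_def y_def shift)
  have xy: "((\<lambda>n. (1/2) * (x n + y n)) has_sum (1/2) * (infsum x UNIV + infsum y UNIV)) UNIV"
    using x y by (intro has_sum_cmult_right has_sum_add has_sum_infsum)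
  have sm: "(\<lambda>n. cmod (G_term g a b k t n)) summable_on UNIV"
    by (rule summable_on_comparison_test[OF has_sum_imp_summable[OF xy]]) (use le in auto)
  have "(\<Sum>\<^sub>\<infinity>n. cmod (G_term g a b k t n)) \<le> (1/2) * (infsum x UNIV + infsum y UNIV)"
    by (rule has_sum_mono[OF has_sum_infsum[OF sm] xy le])
  with sm x y show ?thesis by simp
qed

lemma has_sum_finite_sum:
  fixes f :: "'i \<Rightarrow> 'a \<Rightarrow> 'b :: topological_comm_monoid_add"
  assumes "finite I" "\<And>i. i \<in> I \<Longrightarrow> (f i has_sum s i) A"
  shows "((\<lambda>x. \<Sum>i\<in>I. f i x) has_sum (\<Sum>i\<in>I. s i)) A"
  using assms by (induction rule: finite_induct) (auto intro: has_sum_add)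

lemma compactly_supported_floor_bound:
  assumes "compactly_supported f"
  obtains N where "\<And>t. f t \<noteq> 0 \<Longrightarrow> \<lfloor>b * t\<rfloor> \<in> {- N..N}"
proof -
  have "bounded (closure {x. f x \<noteq> 0})"
    using assms compact_imp_bounded by (auto simp: compactly_supported_def)
  then obtain R where R: "\<And>x. f x \<noteq> 0 \<Longrightarrow> \<bar>x\<bar> \<le> R"
    using closure_subset[of "{x. f x \<noteq> 0}"] by (auto simp: bounded_iff)
  have "\<lfloor>b * t\<rfloor> \<in> {- (\<lceil>\<bar>b\<bar> * R\<rceil> + 1)..\<lceil>\<bar>b\<bar> * R\<rceil> + 1}" if "f t \<noteq> 0" for t
  proof -
    have "\<bar>b * t\<bar> \<le> \<bar>b\<bar> * R"
      unfolding abs_mult using R[OF that] by (intro mult_left_mono) auto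
    then show ?thesis unfolding atLeastAtMost_iff by linarith
  qed
  then show thesis by (rule that)
qed

text \<open>
  Below, \<open>X n\<close> is the value of the sum over \<open>m\<close> for fixed \<open>n\<close>, computed as a finite
  combination of integrals, and \<open>W k\<close> is the integral of the frame integrand. Summing \<open>X n\<close> over \<open>n\<close>
  under the integrals yields the right-hand side; the sums over \<open>m\<close> and \<open>n\<close> may be combined into
  one because the terms are nonnegative.
\<close>

lemma WH_frame_identity_if_orbit_bound:
  assumes b: "b > 0" and g: "g \<in> borel_measurable lebesgue"
    and orb: "AE t in lebesgue. orbit_bound g a B t"
    and f: "L2 lebesgue f" and supp: "\<And>t. f t \<noteq> 0 \<Longrightarrow> \<lfloor>b * t\<rfloor> \<in> {- N..N}"
  shows "WH_frame_identity g a b f"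
proof -
  define F where "F k t = cnj (f t) * f (t - of_int k / b)" for k t
  define h where "h n t = f t * cnj (g (t - of_int n * a))" for n t
  define Q where "Q m n = (cmod (L2_inner f (WH_atom g a b m n)))\<^sup>2" for m n
  define X where "X n = 1 / complex_of_real b * (\<Sum>k\<in>{- 2 * N..2 * N}. LINT t|lebesgue. F k t * G_term g a b k t n)" for n
  define W where "W k = (LINT t|lebesgue. WH_integrand g a b f k t)" for k
  have g_bnd: "AE t in lebesgue. (cmod (g (t - of_int n * a)))\<^sup>2 \<le> B" for n
    using orb by eventually_elim (rule orbit_bound_term)
  have g_shift: "(\<lambda>t. g (t - of_int n * a)) \<in> borel_measurable lebesgue" for n
    using measurable_lebesgue_shift[OF g, of "- (of_int n * a)"] by simp
  have f_meas: "f \<in> borel_measurable lebesgue" using f by (simp add: L2_def)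
  have h_L2: "L2 lebesgue (h n)" for n
    unfolding L2_def
  proof
    show meas: "h n \<in> borel_measurable lebesgue"
      unfolding h_def using f_meas g_shift by measurable
    show "integrable lebesgue (\<lambda>t. (cmod (h n t))\<^sup>2)"
    proof (rule Bochner_Integration.integrable_bound)
      show "integrable lebesgue (\<lambda>t. B * (cmod (f t))\<^sup>2)" using f by (simp add: L2_def)
      show "(\<lambda>t. (cmod (h n t))\<^sup>2) \<in> borel_measurable lebesgue" using meas by measurable
      show "AE t in lebesgue. norm ((cmod (h n t))\<^sup>2) \<le> norm (B * (cmod (f t))\<^sup>2)"
        using g_bnd[of n]
      proof eventually_elim
        case (elim t)
        then have "(cmod (f t))\<^sup>2 * (cmod (g (t - of_int n * a)))\<^sup>2 \<le> (cmod (f t))\<^sup>2 * B"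
          by (rule mult_left_mono) simp
        then show ?case by (auto simp: h_def norm_mult power_mult_distrib mult.commute intro: order_trans[OF _ abs_ge_self])
      qed
    qed
  qed
  have h_supp: "\<lfloor>b * t\<rfloor> \<in> {- N..N}" if "h n t \<noteq> 0" for n t
    using that supp by (auto simp: h_def)
  have h_int: "integrable lebesgue (h n)" for n
    by (rule L2_bounded_support_integrable[OF h_L2 b _ h_supp]) auto
  have atom: "f x * cnj (WH_atom g a b m n x) = h n x * cnj (echar b m x)" for m n x
    by (simp add: WH_atom_eq h_def)
  have int_atom: "integrable lebesgue (\<lambda>x. f x * cnj (WH_atom g a b m n x))" for m n
    unfolding atom
    by (rule Bochner_Integration.integrable_bound[OF h_int[of n]])
      (use h_L2[of n] in \<open>auto simp: L2_def norm_mult\<close>)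
  have rows: "((\<lambda>m. complex_of_real (Q m n)) has_sum X n) UNIV" for n
  proof -
    have shift: "t - of_int k / b - of_int n * a = t - of_int n * a - of_int k / b" for k t
      by simp
    have "cnj (h n t) * h n (t - of_int k / b) = F k t * G_term g a b k t n" for k t
      by (simp add: h_def F_def G_term_def shift)
    with parseval_bounded_support[OF b h_L2 h_supp, of n]
    show ?thesis by (simp add: Q_def L2_inner_def atom X_def)
  qed

  have F_int: "integrable lebesgue (F k)" for k
    using L2_mult_integrable[OF L2_shift[OF f, of "- of_int k / b"] f] by (simp add: F_def[abs_def] mult.commute)
  have G_bnd: "AE t in lebesgue. (\<lambda>n. cmod (G_term g a b k t n)) summable_on UNIV \<and>
      (\<Sum>\<^sub>\<infinity>n. cmod (G_term g a b k t n)) \<le> B" for k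
  proof -
    have "AE t in lebesgue. orbit_bound g a B (t + (- of_int k / b))"
      by (rule AE_lebesgue_shift[OF orb])
    with orb show ?thesis
      by eventually_elim (auto intro!: orbit_bound_G_term)
  qed
  have G_meas: "(\<lambda>t. G_term g a b k t n) \<in> borel_measurable lebesgue" for k n
  proof -
    have "(\<lambda>t. g (t - of_int n * a - of_int k / b)) \<in> borel_measurable lebesgue"
      using measurable_lebesgue_shift[OF g, of "- (of_int n * a) - of_int k / b"] by (simp add: algebra_simps)
    then show ?thesis unfolding G_term_def using g_shift[of n] by measurable
  qed
  have FG_int: "integrable lebesgue (\<lambda>t. F k t * G_term g a b k t n)" for k n
  proof (rule Bochner_Integration.integrable_bound)
    show "integrable lebesgue (\<lambda>t. F k t * complex_of_real B)" using F_int[of k] by simp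
    show "(\<lambda>t. F k t * G_term g a b k t n) \<in> borel_measurable lebesgue"
      using borel_measurable_integrable[OF F_int[of k]] G_meas by measurable
    show "AE t in lebesgue. norm (F k t * G_term g a b k t n) \<le> norm (F k t * complex_of_real B)"
      using G_bnd[of k]
    proof eventually_elim
      case (elim t)
      then have "cmod (G_term g a b k t n) \<le> B"
        using finite_sum_le_infsum[of "\<lambda>n. cmod (G_term g a b k t n)" UNIV "{n}"] by auto
      then show ?case by (auto simp: norm_mult intro!: mult_left_mono)
    qed
  qed
  have dom: "AE t in lebesgue. (\<lambda>n. cmod (F k t * G_term g a b k t n)) summable_on UNIV \<and>
      (\<Sum>\<^sub>\<infinity>n. cmod (F k t * G_term g a b k t n)) \<le> cmod (F k t) * B" for k
    using G_bnd[of k]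
  proof eventually_elim
    case (elim t)
    then show ?case
      by (auto simp: norm_mult infsum_cmult_right' intro: summable_on_cmult_right mult_left_mono)
  qed
  have wint: "integrable lebesgue (\<lambda>t. cmod (F k t) * B)" for k using F_int[of k] by simp
  have integrand: "(\<lambda>t. \<Sum>\<^sub>\<infinity>n. F k t * G_term g a b k t n) = WH_integrand g a b f k" for k
    by (simp add: fun_eq_iff WH_integrand_def G_def F_def infsum_cmult_right')
  have W_int: "integrable lebesgue (WH_integrand g a b f k)" for k
    using integrable_infsum_int[OF FG_int wint dom, of k] by (simp add: integrand)
  have W_sum: "((\<lambda>n. LINT t|lebesgue. F k t * G_term g a b k t n) has_sum W k) UNIV" for k
    using has_sum_integral_int[OF FG_int wint dom, of k] by (simp add: integrand W_def fun_cong[OF integrand])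

  \<comment> \<open>Nonnegativity is used over the reals, while \<open>X\<close> and \<open>Z\<close> are complex: both are first shown to be real.\<close>
  define Z where "Z = 1 / complex_of_real b * (\<Sum>k\<in>{- 2 * N..2 * N}. W k)"
  have X_sum: "(X has_sum Z) UNIV"
    unfolding X_def Z_def by (intro has_sum_cmult_right has_sum_finite_sum W_sum) auto
  have rows_real: "((\<lambda>m. Q m n) has_sum Re (X n)) UNIV" for n
    using has_sum_Re[OF rows[of n]] by simp
  have X_real: "X n = complex_of_real (Re (X n))" for n
    using has_sum_unique[OF rows[of n] has_sum_of_real[OF rows_real]] .
  have ReX_sum: "((\<lambda>n. Re (X n)) has_sum Re Z) UNIV"
    using has_sum_Re[OF X_sum] by simp
  have Z_real: "Z = complex_of_real (Re Z)"
  proof (rule has_sum_unique[OF X_sum])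
    show "(X has_sum complex_of_real (Re Z)) UNIV"
      using has_sum_of_real[OF ReX_sum, where 'a = complex] unfolding X_real[symmetric] .
  qed
  have "(\<lambda>(n, m). Q m n) summable_on UNIV \<times> UNIV"
    by (rule summable_on_SigmaI[OF _ has_sum_imp_summable[OF ReX_sum]])
      (use rows_real in \<open>auto simp: Q_def\<close>)
  then have "((\<lambda>(n, m). Q m n) has_sum Re Z) (UNIV \<times> UNIV)"
    by (intro has_sum_SigmaI[OF _ ReX_sum]) (use rows_real in auto)
  then have Q_sum: "((\<lambda>(m, n). Q m n) has_sum Re Z) UNIV"
    by (subst (asm) has_sum_swap) simp
  have W_zero: "W k = 0" if "k \<notin> {- 2 * N..2 * N}" for k
  proof -
    have "F k t = 0" for t
    proof (rule ccontr)
      assume "F k t \<noteq> 0"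
      then have "\<lfloor>b * t\<rfloor> \<in> {- N..N}" "\<lfloor>b * (t - of_int k / b)\<rfloor> \<in> {- N..N}"
        using supp by (auto simp: F_def)
      moreover have "\<lfloor>b * (t - of_int k / b)\<rfloor> = \<lfloor>b * t\<rfloor> - k"
        using b by (simp add: right_diff_distrib)
      ultimately show False using that by auto
    qed
    then have "WH_integrand g a b f k t = 0" for t by (simp only: WH_integrand_def F_def mult_zero_left)
    then show ?thesis by (simp add: W_def)
  qed
  have W_total: "(W has_sum (\<Sum>k\<in>{- 2 * N..2 * N}. W k)) UNIV"
    by (rule has_sum_finite_neutralI[of "{- 2 * N..2 * N}"]) (use W_zero in auto)
  show ?thesis
    unfolding WH_frame_identity_def Q_def[symmetric] W_def[symmetric]
  proof (intro conjI allI)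
    show "AE t in lebesgue. cnj (f t) * f (t - of_int k / b) \<noteq> 0 \<longrightarrow>
        (\<lambda>n. cmod (G_term g a b k t n)) summable_on UNIV" for k
      using G_bnd[of k] by eventually_elim simp
    show "(\<lambda>(m, n). Q m n) summable_on UNIV" by (rule has_sum_imp_summable[OF Q_sum])
    show "W summable_on UNIV" by (rule has_sum_imp_summable[OF W_total])
    show "complex_of_real (\<Sum>\<^sub>\<infinity>(m, n). Q m n) = 1 / complex_of_real b * (\<Sum>\<^sub>\<infinity>k. W k)"
      unfolding infsumI[OF Q_sum] infsumI[OF W_total] Z_def[symmetric] by (rule Z_real[symmetric])
  qed (use int_atom W_int in auto)
qed

section \<open>The identity implies bounded orbit sums\<close>

text \<open>
  A gliding hump: if \<open>u\<close> is essentially unbounded, the sets \<open>E n\<close> where \<open>u > 4\<^sup>n\<close> all have positive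
  measure. Spreading mass \<open>2\<^sup>-\<^sup>n\<close> uniformly over each \<open>E n\<close> gives an integrable \<open>\<phi>\<close>, whereas
  the \<open>n\<close>-th hump alone contributes at least \<open>2\<^sup>n\<close> to the integral of \<open>\<phi> u\<close>.
\<close>

lemma AE_bounded_if_products_integrable:
  fixes u :: "'a \<Rightarrow> real"
  assumes S: "S \<in> fmeasurable M" and u: "u \<in> borel_measurable M" and nonneg: "\<And>x. 0 \<le> u x"
    and zero: "\<And>x. x \<notin> S \<Longrightarrow> u x = 0"
    and prod: "\<And>\<phi>. integrable M \<phi> \<Longrightarrow> (\<And>x. 0 \<le> \<phi> x) \<Longrightarrow> (\<And>x. x \<notin> S \<Longrightarrow> \<phi> x = 0) \<Longrightarrow>
        integrable M (\<lambda>x. \<phi> x * u x)"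
  shows "\<exists>B>0. AE x in M. u x \<le> B"
proof (rule ccontr)
  assume unbounded: "\<not> ?thesis"
  define E where "E n = {x \<in> space M. u x > 4 ^ n}" for n :: nat
  have E_S: "E n \<subseteq> S" for n
    using zero by (force simp: E_def)
  have E_sets: "E n \<in> sets M" for n
    unfolding E_def using u by measurable
  have E_fin: "E n \<in> fmeasurable M" for n
    by (rule fmeasurableI2[OF S E_S E_sets])
  have E_pos: "measure M (E n) > 0" for n
  proof (rule ccontr)
    assume "\<not> ?thesis"
    then have "measure M (E n) = 0" using measure_nonneg[of M "E n"] by linarith
    then have "E n \<in> null_sets M"
      using E_fin[of n] by (simp add: null_sets_def emeasure_eq_measure2)
    then have "AE x in M. x \<notin> E n" by (rule AE_not_in)
    then have "AE x in M. u x \<le> 4 ^ n"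
      using AE_space by eventually_elim (auto simp: E_def)
    then show False using unbounded by (meson zero_less_numeral zero_less_power)
  qed
  define c where "c n = (1 / 2 ^ n) / measure M (E n)" for n
  have c_pos: "c n > 0" for n using E_pos by (simp add: c_def)
  define \<psi> where "\<psi> n x = c n * indicator (E n) x" for n x
  define \<phi> where "\<phi> x = (\<Sum>n. \<psi> n x)" for x
  have \<psi>_int: "integrable M (\<psi> n)" for n
    using E_fin[of n] by (auto simp: \<psi>_def[abs_def] fmeasurable_def)
  have \<psi>_nonneg: "0 \<le> \<psi> n x" for n x using c_pos[of n] by (simp add: \<psi>_def)
  have \<psi>_sum: "summable (\<lambda>n. \<psi> n x)" for x
  proof -
    obtain n0 where n0: "u x < 4 ^ n0" using real_arch_pow[of 4 "u x"] by auto
    have "\<psi> n x = 0" if "n \<ge> n0" for n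
    proof -
      have "(4::real) ^ n0 \<le> 4 ^ n" using that by (intro power_increasing) auto
      with n0 have "\<not> 4 ^ n < u x" by linarith
      then show ?thesis by (simp add: \<psi>_def E_def)
    qed
    then show ?thesis by (intro summable_finite[of "{..<n0}"]) auto
  qed
  have \<phi>_int: "integrable M \<phi>"
    unfolding \<phi>_def
  proof (rule integrable_suminf[OF \<psi>_int])
    show "AE x in M. summable (\<lambda>n. norm (\<psi> n x))" using \<psi>_sum \<psi>_nonneg by simp
    have "(LINT x|M. norm (\<psi> n x)) = (1 / 2) ^ n" for n
    proof -
      have "(LINT x|M. norm (\<psi> n x)) = c n * measure M (E n)"
        using \<psi>_nonneg E_fin[of n] sets.Int_space_eq2[OF E_sets[of n]] by (simp add: \<psi>_def abs_mult c_pos less_imp_le)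
      then show ?thesis using E_pos[of n] by (simp add: c_def power_one_over)
    qed
    then show "summable (\<lambda>n. LINT x|M. norm (\<psi> n x))" by (simp add: summable_geometric)
  qed
  have \<phi>_ge: "\<psi> n x \<le> \<phi> x" for n x
    using sum_le_suminf[OF \<psi>_sum, of "{n}"] \<psi>_nonneg by (simp add: \<phi>_def)
  have \<phi>_u: "integrable M (\<lambda>x. \<phi> x * u x)"
  proof (rule prod[OF \<phi>_int])
    show "0 \<le> \<phi> x" for x using \<phi>_ge[of 0] \<psi>_nonneg order_trans by blast
    show "\<phi> x = 0" if "x \<notin> S" for x
    proof -
      have "x \<notin> E n" for n using that E_S[of n] by blast
      then have "\<psi> n x = 0" for n by (simp add: \<psi>_def)
      then show ?thesis by (simp add: \<phi>_def)
    qed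
  qed
  have "2 ^ n \<le> (LINT x|M. \<phi> x * u x)" for n
  proof -
    have "2 ^ n = c n * 4 ^ n * measure M (E n)"
      using E_pos[of n] by (simp add: c_def flip: power_divide)
    also have "\<dots> = (LINT x|M. c n * 4 ^ n * indicator (E n) x)"
      using sets.Int_space_eq2[OF E_sets[of n]] by simp
    also have "\<dots> \<le> (LINT x|M. \<phi> x * u x)"
    proof (rule integral_mono[OF _ \<phi>_u])
      show "integrable M (\<lambda>x. c n * 4 ^ n * indicator (E n) x)"
        using E_fin[of n] by (auto simp: fmeasurable_def)
      show "c n * 4 ^ n * indicator (E n) x \<le> \<phi> x * u x" for x
      proof (cases "x \<in> E n")
        case True
        have "c n * 4 ^ n \<le> \<phi> x * u x"
          using True c_pos[of n] \<phi>_ge[of n x] by (intro mult_mono) (auto simp: \<psi>_def E_def)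
        then show ?thesis using True by simp
      next
        case False
        have "0 \<le> \<phi> x" using \<phi>_ge[of 0] \<psi>_nonneg order_trans by blast
        with False nonneg show ?thesis by simp
      qed
    qed
    finally show ?thesis .
  qed
  moreover obtain n where "(LINT x|M. \<phi> x * u x) < 2 ^ n" using real_arch_pow[of 2] by auto
  ultimately show False by (meson not_le)
qed

lemma orbit_bound_shift: "orbit_bound g a B (t + of_int k * a) \<longleftrightarrow> orbit_bound g a B t"
proof -
  have bij: "bij_betw (\<lambda>n. n - k) UNIV (UNIV :: int set)"
    by (rule bij_betwI[of _ _ _ "\<lambda>n. n + k"]) auto
  have eq: "t + of_int k * a - of_int n * a = t - of_int (n - k) * a" for n
    by (simp add: algebra_simps)
  show ?thesis
    unfolding orbit_bound_def eq
    using summable_on_reindex_bij_betw[OF bij, of "\<lambda>n. (cmod (g (t - of_int n * a)))\<^sup>2"]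
      infsum_reindex_bij_betw[OF bij, of "\<lambda>n. (cmod (g (t - of_int n * a)))\<^sup>2"] by simp
qed

text \<open>
  The integer translates of \<open>[0,a]\<close> by multiples of \<open>a\<close> cover the line, and countably many null sets
  form a null set.
\<close>

lemma AE_orbit_bound_if_on_period:
  assumes a: "a > 0" and ae: "AE t in lebesgue. t \<in> {0..a} \<longrightarrow> orbit_bound g a B t"
  shows "AE t in lebesgue. orbit_bound g a B t"
proof -
  have "AE t in lebesgue. \<forall>k::int. t + of_int k * a \<in> {0..a} \<longrightarrow> orbit_bound g a B t"
    unfolding AE_all_countable
  proof
    fix k :: int
    show "AE t in lebesgue. t + of_int k * a \<in> {0..a} \<longrightarrow> orbit_bound g a B t"
      using AE_lebesgue_shift[OF ae, of "of_int k * a"] unfolding orbit_bound_shift .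
  qed
  then show ?thesis
  proof eventually_elim
    case (elim t)
    have "t + of_int (- \<lfloor>t / a\<rfloor>) * a \<in> {0..a}"
      using floor_divide_lower[OF a, of t] floor_divide_upper[OF a, of t] by (auto simp: algebra_simps)
    with elim show ?case by blast
  qed
qed

lemma infsum_complex_of_real: "(\<Sum>\<^sub>\<infinity>x\<in>A. complex_of_real (f x)) = complex_of_real (\<Sum>\<^sub>\<infinity>x\<in>A. f x)"
proof (cases "f summable_on A")
  case True
  then show ?thesis by (intro infsumI has_sum_of_real has_sum_infsum)
next
  case False
  then have "\<not> (\<lambda>x. complex_of_real (f x)) summable_on A"
    using summable_on_Re[of "\<lambda>x. complex_of_real (f x)" A] by auto
  with False show ?thesis by (simp add: infsum_not_exists)
qed

text \<open>
  The indicator of \<open>[0,a]\<close> as a test function shows that the orbit sum converges almost everywhere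
  there and that its restriction \<open>u\<close> to \<open>[0,a]\<close> is measurable; the square roots of nonnegative
  integrable functions \<open>\<phi>\<close> then show that every \<open>\<phi> u\<close> is integrable.
\<close>

lemma orbit_bound_if_WH_frame_identity:
  assumes a: "a > 0"
    and WH: "\<And>f. L2 lebesgue f \<Longrightarrow> compactly_supported f \<Longrightarrow> WH_frame_identity g a b f"
  shows "\<exists>B>0. AE t in lebesgue. orbit_bound g a B t"
proof -
  have compact_supp: "compactly_supported f" if "\<And>t. t \<notin> {0..a} \<Longrightarrow> f t = 0" for f
  proof -
    have "{x. f x \<noteq> 0} \<subseteq> {0..a}" using that by blast
    then have "bounded {x. f x \<noteq> 0}" by (rule bounded_subset[OF bounded_closed_interval])
    then show ?thesis by (simp add: compactly_supported_def)
  qed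
  define f0 :: "real \<Rightarrow> complex" where "f0 t = indicator {0..a} t" for t
  define u where "u t = Re (WH_integrand g a b f0 0 t)" for t
  have L2_f0: "L2 lebesgue f0"
  proof -
    have "(\<lambda>x. (cmod (f0 x))\<^sup>2) = indicat_real {0..a}" by (auto simp: f0_def indicator_def)
    moreover have "integrable lebesgue (indicat_real {0..a})"
      using lmeasurable_interval(1)[of 0 a] unfolding lmeasurable_iff_integrable .
    moreover have "f0 \<in> borel_measurable lebesgue"
      unfolding f0_def[abs_def] by (rule borel_measurable_indicator) simp
    ultimately show ?thesis by (simp add: L2_def)
  qed
  have WH0: "WH_frame_identity g a b f0"
    by (rule WH[OF L2_f0 compact_supp]) (simp add: f0_def)
  have u_int: "integrable lebesgue u"
    using WH0 unfolding WH_frame_identity_def u_def by (intro integrable_Re) blast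
  have Gt: "G_term g a b 0 t n = complex_of_real ((cmod (g (t - of_int n * a)))\<^sup>2)" for t n
    by (simp add: G_term_def flip: complex_norm_square)
  have G0: "G g a b 0 t = complex_of_real (\<Sum>\<^sub>\<infinity>n. (cmod (g (t - of_int n * a)))\<^sup>2)" for t
    unfolding G_def Gt by (rule infsum_complex_of_real)
  have u_eq: "u t = indicator {0..a} t * (\<Sum>\<^sub>\<infinity>n::int. (cmod (g (t - of_int n * a)))\<^sup>2)" for t
    by (simp add: u_def WH_integrand_def G0 f0_def indicator_def)
  have "\<exists>B>0. AE t in lebesgue. u t \<le> B"
  proof (rule AE_bounded_if_products_integrable)
    show "{0..a} \<in> lmeasurable" by simp
    show "u \<in> borel_measurable lebesgue" using u_int by simp
    show "0 \<le> u t" for t unfolding u_eq by (simp add: infsum_nonneg)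
    show "u t = 0" if "t \<notin> {0..a}" for t unfolding u_eq using that by simp
    fix \<phi> :: "real \<Rightarrow> real"
    assume \<phi>: "integrable lebesgue \<phi>" "\<And>t. 0 \<le> \<phi> t" "\<And>t. t \<notin> {0..a} \<Longrightarrow> \<phi> t = 0"
    define f where "f t = complex_of_real (sqrt (\<phi> t))" for t
    have "L2 lebesgue f"
      using \<phi>(1,2) borel_measurable_integrable[OF \<phi>(1)] by (simp add: L2_def f_def[abs_def])
    then have "WH_frame_identity g a b f"
      by (rule WH[OF _ compact_supp]) (simp add: f_def \<phi>)
    then have "integrable lebesgue (\<lambda>t. Re (WH_integrand g a b f 0 t))"
      unfolding WH_frame_identity_def by (intro integrable_Re) blast
    also have "(\<lambda>t. Re (WH_integrand g a b f 0 t)) = (\<lambda>t. \<phi> t * u t)"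
    proof
      fix t
      have "complex_of_real (sqrt (\<phi> t)) * complex_of_real (sqrt (\<phi> t)) = complex_of_real (\<phi> t)"
        using \<phi>(2)[of t] by (simp flip: of_real_mult)
      then have "Re (WH_integrand g a b f 0 t) = \<phi> t * (\<Sum>\<^sub>\<infinity>n::int. (cmod (g (t - of_int n * a)))\<^sup>2)"
        by (simp add: WH_integrand_def G0 f_def)
      then show "Re (WH_integrand g a b f 0 t) = \<phi> t * u t"
        using \<phi>(3)[of t] by (cases "t \<in> {0..a}") (auto simp: u_eq)
    qed
    finally show "integrable lebesgue (\<lambda>t. \<phi> t * u t)" .
  qed
  then obtain B where B: "B > 0" and u_le: "AE t in lebesgue. u t \<le> B" by blast
  have "AE t in lebesgue. cnj (f0 t) * f0 (t - of_int 0 / b) \<noteq> 0 \<longrightarrow>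
      (\<lambda>n. cmod (G_term g a b 0 t n)) summable_on UNIV"
    using WH0 unfolding WH_frame_identity_def by blast
  with u_le have "AE t in lebesgue. t \<in> {0..a} \<longrightarrow> orbit_bound g a B t"
    by eventually_elim (auto simp: orbit_bound_def u_eq f0_def Gt norm_power)
  then show ?thesis using AE_orbit_bound_if_on_period[OF a] B by blast
qed

theorem theorem4p1:
  fixes a b :: real and g :: "real \<Rightarrow> complex"
  assumes "a > 0" and "b > 0" and "g \<in> borel_measurable lebesgue"
  shows "(\<exists>B>0. AE t in lebesgue.
            (\<lambda>n::int. (cmod (g (t - of_int n * a)))\<^sup>2) summable_on UNIV \<and>
            (\<Sum>\<^sub>\<infinity>n::int. (cmod (g (t - of_int n * a)))\<^sup>2) \<le> B) \<longleftrightarrow>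
         (\<forall>f. square_integrable f \<and> compactly_supported f \<longrightarrow> WH_frame_identity g a b f)"
proof -
  have L2_iff: "square_integrable f \<longleftrightarrow> L2 lebesgue f" for f
    by (simp add: square_integrable_def L2_def)
  show ?thesis
    unfolding orbit_bound_def[symmetric] L2_iff
  proof
    assume "\<exists>B>0. AE t in lebesgue. orbit_bound g a B t"
    then obtain B where B: "AE t in lebesgue. orbit_bound g a B t" by blast
    show "\<forall>f. L2 lebesgue f \<and> compactly_supported f \<longrightarrow> WH_frame_identity g a b f"
    proof (intro allI impI, elim conjE)
      fix f assume f: "L2 lebesgue f" "compactly_supported f"
      obtain N where "\<And>t. f t \<noteq> 0 \<Longrightarrow> \<lfloor>b * t\<rfloor> \<in> {- N..N}"
        using compactly_supported_floor_bound[OF f(2), of b] by blast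
      then show "WH_frame_identity g a b f"
        by (rule WH_frame_identity_if_orbit_bound[OF assms(2,3) B f(1)])
    qed
  next
    assume "\<forall>f. L2 lebesgue f \<and> compactly_supported f \<longrightarrow> WH_frame_identity g a b f"
    then show "\<exists>B>0. AE t in lebesgue. orbit_bound g a B t"
      by (intro orbit_bound_if_WH_frame_identity[OF assms(1)]) blast
  qed
qed

end
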